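(* Let $k$ be an algebraically closed field and $k\subseteq R'\subseteq R$ commutative rings such that $R$ is a finitely generated $k$-algebra and $R$ is integral over $R'$. Let $M$ be a Noetherian $R$-module and let $y$ be a finite tuple of elements of $R'$ generating a maximal ideal of $R'$. Then $\dim_k H_p(y,M)<\infty$ for all $p$ (so $i(y)<\infty$). Moreover, for every $p$, every element of $R'$ acts on $H_p(y,M)$ as a scalar multiple of the identity, while the $R$-module $H_p(y,M)$ has finite length and is triangularizable: writing $R=k[x]$ for an $n$-tuple $x$, there are points $b^{(1)},\ldots,b^{(s)}\in k^n$ ($s=\dim_k H_p(y,M)$) and a $k$-basis of $H_p(y,M)$ in which each $f(x)\in R$ acts by a lower triangular matrix with diagonal entries $f(b^{(1)}),\ldots,f(b^{(s)})$; in particular $\operatorname{Supp}_R(H_p(y,M))$ is a finite set of maximal ideals.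
   Context: For a commutative $k$-algebra $R$, an $R$-module $M$ and an $m$-tuple $y=(y_1,\ldots,y_m)$ in $R$, the Koszul complex $\operatorname{Kos}(y,M)$ is $0\leftarrow M\leftarrow M\otimes_k\wedge^1k^m\leftarrow\cdots\leftarrow M\otimes_k\wedge^mk^m\leftarrow 0$ with differential $\partial(u\otimes e_{i_1}\wedge\cdots\wedge e_{i_p})=\sum_{s=1}^p(-1)^{s+1}y_{i_s}u\otimes e_{i_1}\wedge\cdots\wedge\widehat{e_{i_s}}\wedge\cdots\wedge e_{i_p}$; its homology groups $H_p(y,M)$ are $R$-modules. The index is $i(y)=\sum_{p}(-1)^{p+1}\dim_k H_p(y,M)$, defined (written $i(y)<\infty$) when all these dimensions are finite. *)

theory Defs
  imports "HOL-Computational_Algebra.Polynomial" "HOL-Library.Function_Algebras"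
begin

text \<open>The structure map of the k-algebra R is iota :: 'k => 'r; "k is a subring of R"
  means iota is an injective unital ring homomorphism.\<close>
definition inj_ring_hom :: "('k::field \<Rightarrow> 'r::comm_ring_1) \<Rightarrow> bool" where
  "inj_ring_hom \<iota> \<longleftrightarrow> inj \<iota> \<and> \<iota> 1 = 1 \<and>
     (\<forall>a b. \<iota> (a + b) = \<iota> a + \<iota> b) \<and> (\<forall>a b. \<iota> (a * b) = \<iota> a * \<iota> b)"

definition subring :: "'r::comm_ring_1 set \<Rightarrow> bool" where
  "subring S \<longleftrightarrow> 1 \<in> S \<and> (\<forall>a\<in>S. \<forall>b\<in>S. a + b \<in> S \<and> a - b \<in> S \<and> a * b \<in> S)"

definition ideal_in :: "'r::comm_ring_1 set \<Rightarrow> 'r set \<Rightarrow> bool" where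
  "ideal_in S I \<longleftrightarrow> I \<subseteq> S \<and> 0 \<in> I \<and> (\<forall>a\<in>I. \<forall>b\<in>I. a + b \<in> I) \<and>
     (\<forall>r\<in>S. \<forall>a\<in>I. r * a \<in> I)"

definition maximal_ideal_in :: "'r::comm_ring_1 set \<Rightarrow> 'r set \<Rightarrow> bool" where
  "maximal_ideal_in S I \<longleftrightarrow> ideal_in S I \<and> I \<noteq> S \<and>
     (\<forall>J. ideal_in S J \<and> I \<subseteq> J \<longrightarrow> J = I \<or> J = S)"

definition prime_ideal :: "'r::comm_ring_1 set \<Rightarrow> bool" where
  "prime_ideal P \<longleftrightarrow> ideal_in UNIV P \<and> P \<noteq> UNIV \<and>
     (\<forall>a b. a * b \<in> P \<longrightarrow> a \<in> P \<or> b \<in> P)"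

definition gen_ideal_in :: "'r::comm_ring_1 set \<Rightarrow> (nat \<Rightarrow> 'r) \<Rightarrow> nat \<Rightarrow> 'r set" where
  "gen_ideal_in S y m = {\<Sum>i<m. a i * y i | a. \<forall>i<m. a i \<in> S}"

definition monom_in :: "(nat \<Rightarrow> 'r::comm_ring_1) \<Rightarrow> nat \<Rightarrow> (nat \<Rightarrow> nat) \<Rightarrow> 'r" where
  "monom_in x n \<alpha> = (\<Prod>i<n. x i ^ \<alpha> i)"

definition poly_expr :: "('k::field \<Rightarrow> 'r::comm_ring_1) \<Rightarrow> (nat \<Rightarrow> 'r) \<Rightarrow> nat \<Rightarrow>
    (nat \<Rightarrow> nat) set \<Rightarrow> ((nat \<Rightarrow> nat) \<Rightarrow> 'k) \<Rightarrow> 'r" where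
  "poly_expr \<iota> x n A c = (\<Sum>\<alpha>\<in>A. \<iota> (c \<alpha>) * monom_in x n \<alpha>)"

definition poly_eval_pt :: "nat \<Rightarrow> (nat \<Rightarrow> nat) set \<Rightarrow> ((nat \<Rightarrow> nat) \<Rightarrow> 'k::field) \<Rightarrow>
    (nat \<Rightarrow> 'k) \<Rightarrow> 'k" where
  "poly_eval_pt n A c b = (\<Sum>\<alpha>\<in>A. c \<alpha> * (\<Prod>i<n. b i ^ \<alpha> i))"

definition generates_alg :: "('k::field \<Rightarrow> 'r::comm_ring_1) \<Rightarrow> (nat \<Rightarrow> 'r) \<Rightarrow> nat \<Rightarrow> bool" where
  "generates_alg \<iota> x n \<longleftrightarrow> (\<forall>r. \<exists>A c. finite A \<and> r = poly_expr \<iota> x n A c)"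

definition fin_gen_alg :: "('k::field \<Rightarrow> 'r::comm_ring_1) \<Rightarrow> bool" where
  "fin_gen_alg \<iota> \<longleftrightarrow> (\<exists>x n. generates_alg \<iota> x n)"

definition integral_over :: "'r::comm_ring_1 set \<Rightarrow> bool" where
  "integral_over S \<longleftrightarrow> (\<forall>r. \<exists>p. lead_coeff p = 1 \<and> (\<forall>i. coeff p i \<in> S) \<and> poly p r = 0)"

definition is_module :: "('r::comm_ring_1 \<Rightarrow> 'm::ab_group_add \<Rightarrow> 'm) \<Rightarrow> bool" where
  "is_module smul \<longleftrightarrow> (\<forall>r a b. smul r (a + b) = smul r a + smul r b) \<and>
     (\<forall>r s a. smul (r + s) a = smul r a + smul s a) \<and>
     (\<forall>r s a. smul (r * s) a = smul r (smul s a)) \<and> (\<forall>a. smul 1 a = a)"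

definition submodule :: "('r::comm_ring_1 \<Rightarrow> 'm::ab_group_add \<Rightarrow> 'm) \<Rightarrow> 'm set \<Rightarrow> bool" where
  "submodule smul N \<longleftrightarrow> 0 \<in> N \<and> (\<forall>a\<in>N. \<forall>b\<in>N. a + b \<in> N) \<and> (\<forall>r. \<forall>a\<in>N. smul r a \<in> N)"

definition mod_span :: "('r::comm_ring_1 \<Rightarrow> 'm::ab_group_add \<Rightarrow> 'm) \<Rightarrow> 'm set \<Rightarrow> 'm set" where
  "mod_span smul F = {\<Sum>f\<in>F. smul (a f) f | a. True}"

definition noetherian_module :: "('r::comm_ring_1 \<Rightarrow> 'm::ab_group_add \<Rightarrow> 'm) \<Rightarrow> bool" where
  "noetherian_module smul \<longleftrightarrow>
     (\<forall>N. submodule smul N \<longrightarrow> (\<exists>F. finite F \<and> F \<subseteq> N \<and> N = mod_span smul F))"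

text \<open>M \<otimes> \<wedge>^p k^m is represented by functions c from subsets of {..<m} to M, supported on
  p-element subsets: c J is the coefficient of e_(i_1) \<and> ... \<and> e_(i_p), J = {i_1 < ... < i_p}.\<close>
definition koszul_chains :: "nat \<Rightarrow> nat \<Rightarrow> (nat set \<Rightarrow> 'm::ab_group_add) set" where
  "koszul_chains m p = {c. \<forall>J. c J \<noteq> 0 \<longrightarrow> J \<subseteq> {..<m} \<and> card J = p}"

text \<open>The differential: removing i_s from I = J \<union> {i_s} carries the sign (-1)^(s+1),
  where s - 1 = card {j \<in> J. j < i_s}.\<close>
definition koszul_d :: "('r \<Rightarrow> 'm::ab_group_add \<Rightarrow> 'm) \<Rightarrow> (nat \<Rightarrow> 'r) \<Rightarrow> nat \<Rightarrow>
    (nat set \<Rightarrow> 'm) \<Rightarrow> (nat set \<Rightarrow> 'm)" where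
  "koszul_d smul y m c = (\<lambda>J. \<Sum>i\<in>{..<m} - J.
      (if even (card {j\<in>J. j < i}) then smul (y i) (c (insert i J))
       else - smul (y i) (c (insert i J))))"

definition koszul_cycles :: "('r \<Rightarrow> 'm::ab_group_add \<Rightarrow> 'm) \<Rightarrow> (nat \<Rightarrow> 'r) \<Rightarrow> nat \<Rightarrow> nat \<Rightarrow>
    (nat set \<Rightarrow> 'm) set" where
  "koszul_cycles smul y m p = {c \<in> koszul_chains m p. koszul_d smul y m c = 0}"

definition koszul_boundaries :: "('r \<Rightarrow> 'm::ab_group_add \<Rightarrow> 'm) \<Rightarrow> (nat \<Rightarrow> 'r) \<Rightarrow> nat \<Rightarrow> nat \<Rightarrow>
    (nat set \<Rightarrow> 'm) set" where
  "koszul_boundaries smul y m p = koszul_d smul y m ` koszul_chains m (Suc p)"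

definition chain_smul :: "('r \<Rightarrow> 'm::ab_group_add \<Rightarrow> 'm) \<Rightarrow> 'r \<Rightarrow> (nat set \<Rightarrow> 'm) \<Rightarrow> (nat set \<Rightarrow> 'm)" where
  "chain_smul smul r c = (\<lambda>J. smul r (c J))"

section \<open>Properties of a quotient module H = Z / B (B \<subseteq> Z submodules)\<close>

definition quot_fin_dim :: "('k::field \<Rightarrow> 'r::comm_ring_1) \<Rightarrow> ('r \<Rightarrow> 'v::ab_group_add \<Rightarrow> 'v) \<Rightarrow>
    'v set \<Rightarrow> 'v set \<Rightarrow> bool" where
  "quot_fin_dim \<iota> smul Z B \<longleftrightarrow> (\<exists>F. finite F \<and> F \<subseteq> Z \<and>
     (\<forall>z\<in>Z. \<exists>a. z - (\<Sum>f\<in>F. smul (\<iota> (a f)) f) \<in> B))"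

definition acts_as_scalar :: "('k::field \<Rightarrow> 'r::comm_ring_1) \<Rightarrow> ('r \<Rightarrow> 'v::ab_group_add \<Rightarrow> 'v) \<Rightarrow>
    'v set \<Rightarrow> 'v set \<Rightarrow> 'r \<Rightarrow> bool" where
  "acts_as_scalar \<iota> smul Z B r \<longleftrightarrow> (\<exists>c. \<forall>z\<in>Z. smul r z - smul (\<iota> c) z \<in> B)"

text \<open>H has finite length: strictly increasing chains of R-submodules of H (i.e. submodules
  N with B \<subseteq> N \<subseteq> Z) have bounded length.\<close>
definition quot_finite_length :: "('r::comm_ring_1 \<Rightarrow> 'v::ab_group_add \<Rightarrow> 'v) \<Rightarrow>
    'v set \<Rightarrow> 'v set \<Rightarrow> bool" where
  "quot_finite_length smul Z B \<longleftrightarrow> (\<exists>L::nat. \<forall>(N::nat \<Rightarrow> 'v set) l.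
     (\<forall>i\<le>l. submodule smul (N i) \<and> B \<subseteq> N i \<and> N i \<subseteq> Z) \<and> (\<forall>i<l. N i \<subset> N (Suc i))
     \<longrightarrow> l \<le> L)"

definition quot_triangularizable :: "('k::field \<Rightarrow> 'r::comm_ring_1) \<Rightarrow> ('r \<Rightarrow> 'v::ab_group_add \<Rightarrow> 'v) \<Rightarrow>
    (nat \<Rightarrow> 'r) \<Rightarrow> nat \<Rightarrow> 'v set \<Rightarrow> 'v set \<Rightarrow> bool" where
  "quot_triangularizable \<iota> smul x n Z B \<longleftrightarrow>
    (\<exists>(s::nat) (b::nat \<Rightarrow> nat \<Rightarrow> 'k) (z::nat \<Rightarrow> 'v).
       (\<forall>j<s. z j \<in> Z) \<and>
       (\<forall>a. (\<Sum>j<s. smul (\<iota> (a j)) (z j)) \<in> B \<longrightarrow> (\<forall>j<s. a j = 0)) \<and>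
       (\<forall>w\<in>Z. \<exists>a. w - (\<Sum>j<s. smul (\<iota> (a j)) (z j)) \<in> B) \<and>
       (\<forall>A c. finite A \<longrightarrow> (\<forall>j<s. \<exists>a.
          smul (poly_expr \<iota> x n A c) (z j) - smul (\<iota> (poly_eval_pt n A c (b j))) (z j)
            - (\<Sum>i\<in>{j<..<s}. smul (\<iota> (a i)) (z i)) \<in> B)))"

text \<open>Support of H: primes P with H_P \<noteq> 0, i.e. some class [z] with s[z] \<noteq> 0 for all s \<notin> P.\<close>
definition quot_support :: "('r::comm_ring_1 \<Rightarrow> 'v::ab_group_add \<Rightarrow> 'v) \<Rightarrow> 'v set \<Rightarrow> 'v set \<Rightarrow> 'r set set" where
  "quot_support smul Z B = {P. prime_ideal P \<and> (\<exists>z\<in>Z. \<forall>t. t \<notin> P \<longrightarrow> smul t z \<notin> B)}"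

end

theory Submission
  imports Defs
begin

text \<open>
  Exterior multiplication by \<open>e\<^sub>i\<close> is a homotopy showing that \<open>y\<^sub>i\<close>, hence the maximal ideal \<open>\<mm>\<close> generated
  by \<open>y\<close>, kills \<open>H\<^sub>p(y, M)\<close>. Since \<open>R\<close> is a finite \<open>R'\<close>-module, Nakayama's lemma shows \<open>\<mm>R \<noteq> R\<close>; the
  Nullstellensatz then gives a \<open>k\<close>-point of \<open>R\<close> over \<open>\<mm>\<close>, so that \<open>R'/\<mm> = k\<close> and \<open>R'\<close> acts by scalars.
  The homology is finitely generated over \<open>R\<close>, hence over \<open>R'\<close>, hence over \<open>k\<close>. Integral equations
  reduced modulo \<open>\<mm>\<close> give a common eigenvector of the generators of \<open>R\<close> in every nonzero quotient,
  and splitting these off one at a time yields the triangular basis. The resulting filtration with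
  one-dimensional steps bounds the length of chains of submodules, and its finitely many step
  annihilators are maximal ideals whose product kills the homology.
\<close>

section \<open>Subrings, ideals and the extension of characters\<close>

text \<open>\<open>R'\<close> is not assumed finitely generated over k, so the Nullstellensatz
  cannot be applied to it directly. It is applied to \<open>R\<close>, at a maximal ideal over the
  extension to \<open>R\<close> of the ideal of \<open>y\<close>; Nakayama makes this extension
  proper. The homomorphism from \<open>R\<close> to k obtained there restricts to \<open>R'\<close>
  with a proper kernel containing the ideal of \<open>y\<close>, and maximality makes the two equal.
  The Nullstellensatz itself is proved by extending homomorphisms into k along k, k[x_0],
  k[x_0, x_1], ... one generator at a time. An extension is guaranteed only for homomorphisms that
  do not kill a certain element \<open>u\<close> of the lower ring, so every stage is stated for an
  arbitrary element \<open>v\<close> that has to keep a nonzero value. No quotient is formed: the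
  domain R/P becomes congruence modulo a prime P of \<open>R\<close>, and homology becomes a pair of
  submodules of the chains.\<close>

lemma subring_0: "subring S \<Longrightarrow> 0 \<in> S"
  unfolding subring_def by (metis diff_self)

lemma subring_1: "subring S \<Longrightarrow> 1 \<in> S"
  and subring_add: "subring S \<Longrightarrow> a \<in> S \<Longrightarrow> b \<in> S \<Longrightarrow> a + b \<in> S"
  and subring_diff: "subring S \<Longrightarrow> a \<in> S \<Longrightarrow> b \<in> S \<Longrightarrow> a - b \<in> S"
  and subring_mult: "subring S \<Longrightarrow> a \<in> S \<Longrightarrow> b \<in> S \<Longrightarrow> a * b \<in> S"
  unfolding subring_def by auto

lemma subring_uminus: "subring S \<Longrightarrow> a \<in> S \<Longrightarrow> - a \<in> S"
  using subring_diff[of S 0 a] subring_0[of S] by simp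

lemma subring_sum: "subring S \<Longrightarrow> (\<And>i. i \<in> I \<Longrightarrow> f i \<in> S) \<Longrightarrow> sum f I \<in> S"
  by (induction I rule: infinite_finite_induct) (auto intro: subring_0 subring_add)

lemma subring_power: "subring S \<Longrightarrow> a \<in> S \<Longrightarrow> a ^ n \<in> S"
  by (induction n) (auto intro: subring_1 subring_mult)

lemmas subring_intros =
  subring_0 subring_1 subring_add subring_diff subring_mult subring_uminus subring_sum subring_power

lemma subring_UNIV: "subring UNIV"
  by (simp add: subring_def)

lemma ideal_in_subset: "ideal_in S I \<Longrightarrow> a \<in> I \<Longrightarrow> a \<in> S"
  and ideal_in_0: "ideal_in S I \<Longrightarrow> 0 \<in> I"
  and ideal_in_add: "ideal_in S I \<Longrightarrow> a \<in> I \<Longrightarrow> b \<in> I \<Longrightarrow> a + b \<in> I"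
  and ideal_in_mult: "ideal_in S I \<Longrightarrow> r \<in> S \<Longrightarrow> a \<in> I \<Longrightarrow> r * a \<in> I"
  unfolding ideal_in_def by auto

lemma ideal_in_sum: "ideal_in S I \<Longrightarrow> (\<And>j. j \<in> K \<Longrightarrow> f j \<in> I) \<Longrightarrow> sum f K \<in> I"
  by (induction K rule: infinite_finite_induct) (auto intro: ideal_in_0 ideal_in_add)

lemma ideal_in_uminus: "ideal_in S I \<Longrightarrow> subring S \<Longrightarrow> a \<in> I \<Longrightarrow> - a \<in> I"
  using ideal_in_mult[of S I "- 1" a] by (simp add: subring_1 subring_uminus)

lemma ideal_in_diff: "ideal_in S I \<Longrightarrow> subring S \<Longrightarrow> a \<in> I \<Longrightarrow> b \<in> I \<Longrightarrow> a - b \<in> I"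
  using ideal_in_add[of S I a "- b"] ideal_in_uminus[of S I b] by simp

lemma ideal_in_eq_iff:
  assumes "ideal_in S I" "subring S"
  shows "1 \<in> I \<longleftrightarrow> I = S"
  using ideal_in_mult[OF assms(1), of _ 1] ideal_in_subset[OF assms(1)] subring_1[OF assms(2)] by auto

lemma ideal_cong: "ideal_in S I \<Longrightarrow> subring S \<Longrightarrow> a - b \<in> I \<Longrightarrow> a \<in> I \<longleftrightarrow> b \<in> I"
  using ideal_in_diff[of S I a "a - b"] ideal_in_add[of S I "a - b" b] by auto

text \<open>Properness is recorded as \<open>1 \<notin> I\<close>, a condition that passes to unions
  of chains, so Zorn's lemma applies.\<close>

lemma exists_maximal_ideal:
  assumes J: "ideal_in S J" "1 \<notin> J" and S: "subring S"
  shows "\<exists>P. maximal_ideal_in S P \<and> J \<subseteq> P"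
proof -
  let ?A = "{I. ideal_in S I \<and> J \<subseteq> I \<and> 1 \<notin> I}"
  have "\<exists>M\<in>?A. \<forall>X\<in>?A. M \<subseteq> X \<longrightarrow> X = M"
  proof (rule subset_Zorn_nonempty)
    show "?A \<noteq> {}" using J by blast
    fix C assume C: "C \<noteq> {}" "subset.chain ?A C"
    have id: "\<And>I. I \<in> C \<Longrightarrow> ideal_in S I \<and> J \<subseteq> I \<and> 1 \<notin> I"
      and tot: "\<And>I I'. I \<in> C \<Longrightarrow> I' \<in> C \<Longrightarrow> I \<subseteq> I' \<or> I' \<subseteq> I"
      using C(2) unfolding subset.chain_def by auto
    have "a + b \<in> \<Union>C" if ab: "a \<in> \<Union>C" "b \<in> \<Union>C" for a b
    proof -
      obtain I I' where "I \<in> C" "a \<in> I" "I' \<in> C" "b \<in> I'" using ab by auto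
      then show ?thesis using tot[of I I'] id ideal_in_add by blast
    qed
    moreover have "0 \<in> \<Union>C" using C(1) id ideal_in_0 by blast
    moreover have "\<Union>C \<subseteq> S" "J \<subseteq> \<Union>C" "1 \<notin> \<Union>C"
      using id C(1) ideal_in_subset by blast+
    moreover have "r * a \<in> \<Union>C" if "r \<in> S" "a \<in> \<Union>C" for r a
      using that id ideal_in_mult by blast
    ultimately show "\<Union>C \<in> ?A" unfolding ideal_in_def by blast
  qed
  then obtain M where M: "ideal_in S M" "J \<subseteq> M" "1 \<notin> M"
    and mx: "\<And>X. ideal_in S X \<Longrightarrow> J \<subseteq> X \<Longrightarrow> 1 \<notin> X \<Longrightarrow> M \<subseteq> X \<Longrightarrow> X = M" by auto
  have "maximal_ideal_in S M"
    unfolding maximal_ideal_in_def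
    using M mx ideal_in_eq_iff[OF _ S] by (metis order_trans)
  then show ?thesis using M by blast
qed

lemma maximal_imp_prime_ideal:
  fixes P :: "'r::comm_ring_1 set"
  assumes "maximal_ideal_in UNIV P"
  shows "prime_ideal P"
proof -
  have P: "ideal_in UNIV P" "P \<noteq> UNIV"
    and mx: "\<And>J. ideal_in UNIV J \<Longrightarrow> P \<subseteq> J \<Longrightarrow> J = P \<or> J = UNIV"
    using assms unfolding maximal_ideal_in_def by auto
  have "b \<in> P" if ab: "a * b \<in> P" and a: "a \<notin> P" for a b
  proof -
    let ?J = "{p + r * a | p r. p \<in> P}"
    have "ideal_in UNIV ?J"
      unfolding ideal_in_def
    proof (intro conjI ballI)
      show "0 \<in> ?J" using ideal_in_0[OF P(1)] by (metis (mono_tags, lifting) add_0 mem_Collect_eq mult_zero_left)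
      show "u + w \<in> ?J" if uw: "u \<in> ?J" "w \<in> ?J" for u w
      proof -
        obtain p r p' r' where "u = p + r * a" "w = p' + r' * a" "p \<in> P" "p' \<in> P" using uw by blast
        then have "u + w = (p + p') + (r + r') * a" "p + p' \<in> P"
          using ideal_in_add[OF P(1)] by (auto simp: algebra_simps)
        then show ?thesis by blast
      qed
      show "t * u \<in> ?J" if u: "u \<in> ?J" for t u
      proof -
        obtain p r where "u = p + r * a" "p \<in> P" using u by blast
        then have "t * u = t * p + (t * r) * a" "t * p \<in> P"
          using ideal_in_mult[OF P(1), of t p] by (simp_all add: distrib_left mult.assoc)
        then show ?thesis by blast
      qed
    qed simp
    moreover have "P \<subseteq> ?J" by (force intro: exI[of _ 0])
    moreover have "a \<in> ?J" using ideal_in_0[OF P(1)] by (force intro: exI[of _ 0] exI[of _ 1])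
    ultimately have "1 \<in> ?J" using mx a by blast
    then obtain p r where pr: "1 = p + r * a" "p \<in> P" by blast
    have "b = b * p + r * (a * b)"
      using arg_cong[OF pr(1), of "\<lambda>t. t * b"] by (simp add: algebra_simps)
    also have "\<dots> \<in> P" using pr(2) ab ideal_in_mult[OF P(1)] ideal_in_add[OF P(1)] by auto
    finally show ?thesis .
  qed
  then show ?thesis using P unfolding prime_ideal_def by blast
qed

text \<open>Bounding the number of coefficients rather than the degree gives zero no special status.\<close>

definition pol :: "'r::comm_ring_1 set \<Rightarrow> nat \<Rightarrow> 'r poly set" where
  "pol A N = {p. (\<forall>i. coeff p i \<in> A) \<and> (\<forall>i\<ge>N. coeff p i = 0)}"

definition adj :: "'r::comm_ring_1 set \<Rightarrow> 'r \<Rightarrow> 'r set" where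
  "adj A x = {poly p x | p. \<forall>i. coeff p i \<in> A}"

lemma polD: "p \<in> pol A N \<Longrightarrow> coeff p i \<in> A" "p \<in> pol A N \<Longrightarrow> N \<le> i \<Longrightarrow> coeff p i = 0"
  by (auto simp: pol_def)

lemma pol_exists: "\<forall>i. coeff p i \<in> A \<Longrightarrow> \<exists>N. p \<in> pol A N"
  by (rule exI[of _ "Suc (degree p)"]) (auto simp: pol_def coeff_eq_0)

lemma pol_mono: "p \<in> pol A N \<Longrightarrow> N \<le> N' \<Longrightarrow> p \<in> pol A N'"
  by (auto simp: pol_def)

section \<open>Division of polynomials without inverting leading coefficients\<close>

lemma pol_drop_lead:
  assumes "subring A" "g \<in> pol A (Suc N)"
  shows "g - monom (coeff g N) N \<in> pol A N"
  using assms by (auto simp: pol_def le_Suc_eq coeff_diff Suc_le_eq intro!: subring_intros)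

lemma coeff_mult_in:
  assumes "subring A" "\<forall>i. coeff p i \<in> A" "\<forall>i. coeff q i \<in> A"
  shows "coeff (p * q) i \<in> A"
  using assms by (auto simp: coeff_mult intro!: subring_intros)

text \<open>Cross-multiplying by the two leading coefficients cancels position \<open>N\<close>
  without division, which keeps all coefficients in \<open>A\<close>.\<close>

lemma pol_reduce:
  assumes A: "subring A" and f: "f \<in> pol A (Suc e)" and t: "t \<in> pol A (Suc N)" and "e \<le> N"
  shows "smult (coeff f e) t - monom (coeff t N) (N - e) * f \<in> pol A N"
proof -
  have "coeff (smult (coeff f e) t - monom (coeff t N) (N - e) * f) i = 0" if "i \<ge> N" for i
  proof (cases "i = N")
    case True
    then show ?thesis using \<open>e \<le> N\<close> by (simp add: coeff_monom_mult)
  next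
    case False
    then have "coeff t i = 0" "coeff f (i - (N - e)) = 0" using that \<open>e \<le> N\<close> polD[OF t] polD[OF f] by auto
    then show ?thesis by (simp add: coeff_monom_mult)
  qed
  then show ?thesis
    using A polD(1)[OF f] polD(1)[OF t] unfolding pol_def
    by (auto simp: coeff_monom_mult intro!: subring_intros)
qed

text \<open>Each reduction step multiplies \<open>t\<close> once more by \<open>coeff q e\<close>,
  which need not be a unit; this is the origin of the power \<open>k\<close>. The bound on the
  cofactor \<open>q'\<close> matters as much as the one on the remainder: it later places
  \<open>q'\<close> below a minimal degree.\<close>

lemma pol_pseudo_divide:
  assumes A: "subring A" and q: "q \<in> pol A (Suc e)" and t: "t \<in> pol A N"
  shows "\<exists>k q' r. q' \<in> pol A (N - e) \<and> r \<in> pol A e \<and> smult (coeff q e ^ k) t = q * q' + r"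
  using t
proof (induction N arbitrary: t)
  case 0
  then have "t = 0" by (auto simp: pol_def poly_eq_iff)
  then show ?case by (intro exI[of _ 0]) (auto simp: pol_def subring_0[OF A])
next
  case (Suc N)
  show ?case
  proof (cases "Suc N \<le> e")
    case True
    then have "smult (coeff q e ^ 0) t = q * 0 + t" "t \<in> pol A e"
      using pol_mono[OF Suc.prems] by auto
    moreover have "0 \<in> pol A (Suc N - e)" by (auto simp: pol_def subring_0[OF A])
    ultimately show ?thesis by blast
  next
    case False
    let ?l = "coeff q e" and ?m = "monom (coeff t N) (N - e)"
    obtain k q' r where *: "q' \<in> pol A (N - e)" "r \<in> pol A e"
      "smult (?l ^ k) (smult ?l t - ?m * q) = q * q' + r"
      using Suc.IH[OF pol_reduce[OF A q Suc.prems]] False by auto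
    have "smult (?l ^ Suc k) t = q * (q' + smult (?l ^ k) ?m) + r"
      using *(3) by (simp add: smult_diff_right algebra_simps)
    moreover have "q' + smult (?l ^ k) ?m \<in> pol A (Suc N - e)"
      using *(1) False polD(1)[OF q] polD(1)[OF Suc.prems] A
      by (auto simp: pol_def intro!: subring_intros)
    ultimately show ?thesis using *(2) by blast
  qed
qed

text \<open>A character of \<open>A\<close> relative to \<open>P\<close> is a ring homomorphism from \<open>A / (A \<inter> P)\<close> to the field.\<close>

definition is_char :: "'r::comm_ring_1 set \<Rightarrow> 'r set \<Rightarrow> ('r \<Rightarrow> 'k::field) \<Rightarrow> bool" where
  "is_char P A \<phi> \<longleftrightarrow> \<phi> 1 = 1 \<and> (\<forall>a\<in>A. \<forall>b\<in>A. \<phi> (a + b) = \<phi> a + \<phi> b \<and> \<phi> (a * b) = \<phi> a * \<phi> b) \<and>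
     (\<forall>a\<in>A \<inter> P. \<phi> a = 0)"

lemma is_charD:
  assumes "is_char P A \<phi>"
  shows "\<phi> 1 = 1" "a \<in> A \<Longrightarrow> b \<in> A \<Longrightarrow> \<phi> (a + b) = \<phi> a + \<phi> b"
    "a \<in> A \<Longrightarrow> b \<in> A \<Longrightarrow> \<phi> (a * b) = \<phi> a * \<phi> b" "a \<in> A \<Longrightarrow> a \<in> P \<Longrightarrow> \<phi> a = 0"
  using assms unfolding is_char_def by auto

section \<open>Extension of characters by one generator\<close>

context
  fixes A P :: "'r::comm_ring_1 set" and \<phi> :: "'r \<Rightarrow> 'k::field"
  assumes A: "subring A" and \<phi>: "is_char P A \<phi>"
begin

lemma char_0: "\<phi> 0 = 0"
  using is_charD(2)[OF \<phi>, of 0 0] subring_0[OF A] by (metis add_0 add_cancel_right_right)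

lemma char_diff: "a \<in> A \<Longrightarrow> b \<in> A \<Longrightarrow> \<phi> (a - b) = \<phi> a - \<phi> b"
  using is_charD(2)[OF \<phi>, of "a - b" b] subring_diff[OF A] by simp

lemma char_sum: "(\<And>i. i \<in> I \<Longrightarrow> f i \<in> A) \<Longrightarrow> \<phi> (sum f I) = (\<Sum>i\<in>I. \<phi> (f i))"
  by (induction I rule: infinite_finite_induct)
    (auto simp: char_0 is_charD(2)[OF \<phi>] subring_sum[OF A])

lemma map_poly_char_diff:
  "\<forall>i. coeff p i \<in> A \<Longrightarrow> \<forall>i. coeff q i \<in> A \<Longrightarrow> map_poly \<phi> (p - q) = map_poly \<phi> p - map_poly \<phi> q"
  by (rule poly_eqI) (simp add: coeff_map_poly char_0 char_diff)

lemma map_poly_char_add: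
  "\<forall>i. coeff p i \<in> A \<Longrightarrow> \<forall>i. coeff q i \<in> A \<Longrightarrow> map_poly \<phi> (p + q) = map_poly \<phi> p + map_poly \<phi> q"
  by (rule poly_eqI) (simp add: coeff_map_poly char_0 is_charD(2)[OF \<phi>])

lemma map_poly_char_mult:
  "\<forall>i. coeff p i \<in> A \<Longrightarrow> \<forall>i. coeff q i \<in> A \<Longrightarrow> map_poly \<phi> (p * q) = map_poly \<phi> p * map_poly \<phi> q"
  by (rule poly_eqI)
    (simp add: coeff_map_poly char_0 coeff_mult char_sum is_charD(3)[OF \<phi>] subring_mult[OF A])

text \<open>An extension sending \<open>x\<close> to \<xi> must be evaluation at \<xi>. Two
  polynomials with the same value at \<open>x\<close> differ by one with value 0, which lies in
  \<open>P\<close>, so the hypothesis on \<xi> makes the result independent of the chosen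
  polynomial.\<close>

lemma char_extend_at:
  assumes P: "ideal_in UNIV P"
    and \<xi>: "\<And>g. \<forall>i. coeff g i \<in> A \<Longrightarrow> poly g x \<in> P \<Longrightarrow> poly (map_poly \<phi> g) \<xi> = 0"
  shows "\<exists>\<psi>. is_char P (adj A x) \<psi> \<and> (\<forall>p. (\<forall>i. coeff p i \<in> A) \<longrightarrow> \<psi> (poly p x) = poly (map_poly \<phi> p) \<xi>)"
proof -
  let ?ev = "\<lambda>p. poly (map_poly \<phi> p) \<xi>"
  define \<psi> where "\<psi> r = ?ev (SOME p. (\<forall>i. coeff p i \<in> A) \<and> poly p x = r)" for r
  have \<psi>: "\<psi> (poly p x) = ?ev p" if p: "\<forall>i. coeff p i \<in> A" for p
  proof -
    define q where "q = (SOME q. (\<forall>i. coeff q i \<in> A) \<and> poly q x = poly p x)"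
    have q: "(\<forall>i. coeff q i \<in> A) \<and> poly q x = poly p x"
      unfolding q_def by (rule someI[of _ p]) (use p in blast)
    have "?ev (q - p) = 0"
      by (rule \<xi>) (use p q A ideal_in_0[OF P] in \<open>auto intro!: subring_diff\<close>)
    then show ?thesis using map_poly_char_diff[of q p] p q by (simp add: \<psi>_def q_def)
  qed
  have c: "\<forall>i. coeff [:1:] i \<in> A" using A by (auto simp: coeff_pCons subring_0 subring_1 split: nat.split)
  have "is_char P (adj A x) \<psi>"
    unfolding is_char_def
  proof (intro conjI ballI)
    show "\<psi> 1 = 1" using \<psi>[OF c] by (simp add: map_poly_pCons char_0 is_charD(1)[OF \<phi>])
    fix a b assume "a \<in> adj A x" "b \<in> adj A x"
    then obtain p q where pq: "a = poly p x" "\<forall>i. coeff p i \<in> A" "b = poly q x" "\<forall>i. coeff q i \<in> A"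
      unfolding adj_def by auto
    have c: "\<forall>i. coeff (p + q) i \<in> A" "\<forall>i. coeff (p * q) i \<in> A"
      using pq A coeff_mult_in[OF A] by (auto intro: subring_add)
    show "\<psi> (a + b) = \<psi> a + \<psi> b" "\<psi> (a * b) = \<psi> a * \<psi> b"
      using \<psi>[OF c(1)] \<psi>[OF c(2)] \<psi>[OF pq(2)] \<psi>[OF pq(4)] pq
      by (simp_all add: map_poly_char_add map_poly_char_mult)
  next
    fix a assume "a \<in> adj A x \<inter> P"
    then show "\<psi> a = 0" using \<psi> \<xi> unfolding adj_def by auto
  qed
  then show ?thesis using \<psi> by blast
qed

end

text \<open>A root of \<open>q - 1\<close> is a point where \<open>q\<close> takes the value 1;
  constants are treated apart because \<open>q - 1\<close> may then have no root.\<close>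

lemma alg_closed_exists_nonroot:
  fixes q :: "'k::alg_closed_field poly"
  assumes "q \<noteq> 0"
  shows "\<exists>\<xi>. poly q \<xi> \<noteq> 0"
proof (cases "degree q = 0")
  case True
  then obtain c where "q = [:c:]" by (rule degree_eq_zeroE)
  then show ?thesis using assms by auto
next
  case False
  have "coeff (q - 1) (degree q) = coeff q (degree q)" using False by simp
  then have "degree (q - 1) > 0"
    using False assms by (metis bot_nat_0.not_eq_extremum le_degree leading_coeff_0_iff le_zero_eq)
  then obtain \<xi> where "poly (q - 1) \<xi> = 0" using alg_closed_imp_poly_has_root by blast
  then show ?thesis by (intro exI[of _ \<xi>]) auto
qed

text \<open>The element \<open>u\<close> is \<open>a * w\<close>, where \<open>a\<close> is the leading coefficient of a polynomial of minimal degree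
  over \<open>A\<close> vanishing at \<open>x\<close> modulo \<open>P\<close>, and \<open>w \<in> A\<close> is a multiple of \<open>v\<close> modulo \<open>P\<close>.\<close>

lemma char_extension_algebraic:
  fixes A P :: "'r::comm_ring_1 set"
  assumes A: "subring A" and P: "prime_ideal P" and v: "v \<in> adj A x" "v \<notin> P"
    and alg: "\<forall>i. coeff g i \<in> A" "poly g x \<in> P" "coeff g j \<notin> P"
  shows "\<exists>u\<in>A - P. \<forall>\<phi> :: 'r \<Rightarrow> 'k::alg_closed_field. is_char P A \<phi> \<and> \<phi> u \<noteq> 0 \<longrightarrow>
           (\<exists>\<psi>. is_char P (adj A x) \<psi> \<and> (\<forall>a\<in>A. \<psi> a = \<phi> a) \<and> \<psi> v \<noteq> 0)"
proof -
  have I: "ideal_in UNIV P" and one: "1 \<notin> P" and prime: "\<And>a b. a * b \<in> P \<Longrightarrow> a \<in> P \<or> b \<in> P"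
    using P ideal_in_eq_iff[of UNIV P] subring_UNIV unfolding prime_ideal_def by auto
  note [intro] = ideal_in_0[OF I] ideal_in_add[OF I] ideal_in_diff[OF I subring_UNIV] ideal_in_sum[OF I]
  have [intro]: "a * b \<in> P" if "b \<in> P" for a b using ideal_in_mult[OF I _ that] by auto
  have [intro]: "a * b \<in> P" if "a \<in> P" for a b using ideal_in_mult[OF I _ that, of b] by (auto simp: mult.commute)
  have prime_pow: "a ^ k \<notin> P" if "a \<notin> P" for a k
    using that one prime by (induction k) auto
  note cong = ideal_cong[OF I subring_UNIV]
  obtain h where h: "v = poly h x" "\<forall>i. coeff h i \<in> A" using v(1) unfolding adj_def by blast

  \<comment> \<open>The minimal \<open>d\<close> is the degree of \<open>x\<close> over the fraction
    field of \<open>A\<close> modulo \<open>P\<close>. A suitable polynomial arises from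
    \<open>g\<close> by stripping leading coefficients that lie in \<open>P\<close>; the coefficient
    at \<open>j\<close> guarantees that this stops.\<close>
  let ?Q = "\<lambda>d p. p \<in> pol A (Suc d) \<and> poly p x \<in> P \<and> coeff p d \<notin> P"
  have "\<exists>d p. ?Q d p"
  proof -
    have "\<exists>d p. ?Q d p" if "g \<in> pol A N" "poly g x \<in> P" "coeff g j \<notin> P" for N g
      using that
    proof (induction N arbitrary: g)
      case 0
      then show ?case using polD(2)[OF 0(1), of j] by auto
    next
      case (Suc N)
      show ?case
      proof (cases "coeff g N \<in> P")
        case True
        let ?g = "g - monom (coeff g N) N"
        have "?g \<in> pol A N" using pol_drop_lead[OF A Suc.prems(1)] .
        moreover have "poly ?g x \<in> P" using Suc.prems True by (auto simp: poly_monom)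
        moreover have "coeff ?g j \<notin> P" using Suc.prems True by auto
        ultimately show ?thesis using Suc.IH by blast
      qed (use Suc.prems in blast)
    qed
    then show ?thesis using alg pol_exists by blast
  qed
  then obtain d where d: "\<exists>p. ?Q d p" and dmin: "\<And>d' p. d' < d \<Longrightarrow> \<not> ?Q d' p"
    using exists_least_iff[of "\<lambda>d. \<exists>p. ?Q d p"] by blast
  then obtain p where p: "p \<in> pol A (Suc d)" "poly p x \<in> P" "coeff p d \<notin> P" by blast
  \<comment> \<open>Below the minimal degree every relation is trivial modulo \<open>P\<close>:
    minimality puts the top coefficient into \<open>P\<close>, so it can be stripped.\<close>
  have low: "\<forall>i. coeff g i \<in> P" if "g \<in> pol A N" "N \<le> d" "poly g x \<in> P" for g N
    using that
  proof (induction N arbitrary: g)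
    case 0
    then show ?case using polD(2)[OF 0(1)] by auto
  next
    case (Suc N)
    have gN: "coeff g N \<in> P" using dmin[of N g] Suc.prems by auto
    have "poly (g - monom (coeff g N) N) x \<in> P" using Suc.prems gN by (auto simp: poly_monom)
    then have *: "\<forall>i. coeff (g - monom (coeff g N) N) i \<in> P"
      using Suc.IH[OF pol_drop_lead[OF A Suc.prems(1)]] Suc.prems by auto
    have "coeff g i \<in> P" for i using spec[OF *, of i] gN by (cases "i = N") auto
    then show ?case by blast
  qed
  have "d > 0"
  proof (rule ccontr)
    assume "\<not> d > 0"
    then have "p = [:coeff p 0:]" using polD(2)[OF p(1)] by (intro poly_eqI) (auto simp: coeff_pCons split: nat.split)
    then have "poly p x = coeff p 0" by (metis mult_zero_right poly_0 poly_pCons add.right_neutral)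
    then show False using p \<open>\<not> d > 0\<close> by simp
  qed

  \<comment> \<open>These are the polynomial expressions of multiples of \<open>v\<close> that are
    nonzero modulo \<open>P\<close>. If one of minimal degree is a constant, then the ideal of
    \<open>v\<close> meets \<open>A\<close> outside \<open>P\<close>; this replaces inverting
    \<open>v\<close> over a fraction field.\<close>
  let ?T = "\<lambda>e q \<alpha>. q \<in> pol A (Suc e) \<and> poly q x \<notin> P \<and> (\<forall>i. coeff \<alpha> i \<in> A) \<and> poly q x - poly \<alpha> x * v \<in> P"
  have "\<exists>e q \<alpha>. ?T e q \<alpha>"
  proof -
    obtain N where "h \<in> pol A N" using pol_exists[OF h(2)] by blast
    then have "?T N h [:1:]" using h v A pol_mono[of h A N "Suc N"] ideal_in_0[OF I]
      by (auto simp: coeff_pCons subring_0 subring_1 split: nat.split)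
    then show ?thesis by blast
  qed
  then obtain e where e: "\<exists>q \<alpha>. ?T e q \<alpha>" and emin: "\<And>e' q \<alpha>. e' < e \<Longrightarrow> \<not> ?T e' q \<alpha>"
    using exists_least_iff[of "\<lambda>e. \<exists>q \<alpha>. ?T e q \<alpha>"] by blast
  obtain q \<alpha> where q: "q \<in> pol A (Suc e)" "poly q x \<notin> P" "\<forall>i. coeff \<alpha> i \<in> A" "poly q x - poly \<alpha> x * v \<in> P"
    using e by blast
  have emin': "poly r x \<in> P" if "r \<in> pol A e" "\<forall>i. coeff \<beta> i \<in> A" "poly r x - poly \<beta> x * v \<in> P" for r \<beta>
  proof (cases "e = 0")
    case True
    then have "r = 0" using polD(2)[OF that(1)] by (auto simp: poly_eq_iff)
    then show ?thesis by auto
  next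
    case False
    then show ?thesis using emin[of "e - 1" r \<beta>] that by auto
  qed
  define w where "w = coeff q e"
  have wA: "w \<in> A" using polD(1)[OF q(1)] by (simp add: w_def)
  have wP: "w \<notin> P"
  proof
    assume wP: "w \<in> P"
    let ?q = "q - monom w e"
    have qq: "poly q x - poly ?q x \<in> P" using wP by (auto simp: poly_monom)
    have "poly ?q x - poly \<alpha> x * v = (poly q x - poly \<alpha> x * v) - (poly q x - poly ?q x)" by simp
    also have "\<dots> \<in> P" using q(4) qq by blast
    finally have "poly ?q x \<in> P"
      using emin' pol_drop_lead[OF A q(1)] q(3) unfolding w_def by blast
    then show False using cong[OF qq] q(2) by blast
  qed
  have "e = 0"
  proof (rule ccontr)
    assume "e \<noteq> 0"
    \<comment> \<open>Otherwise reducing \<open>q\<close> by \<open>p\<close> gives a smaller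
      multiple of \<open>v\<close>, which minimality puts into \<open>P\<close>; then
      \<open>coeff p d\<close> or \<open>poly q x\<close> would lie in \<open>P\<close>.\<close>
    have "e < d"
    proof (rule ccontr)
      assume "\<not> e < d"
      let ?a = "coeff p d" and ?m = "monom w (e - d)"
      let ?r = "smult ?a q - ?m * p"
      have r: "?r \<in> pol A e" using pol_reduce[OF A p(1) q(1)] \<open>\<not> e < d\<close> by (simp add: w_def)
      have \<beta>: "\<forall>i. coeff (smult ?a \<alpha>) i \<in> A" using polD(1)[OF p(1)] q(3) A by (auto intro: subring_mult)
      have "poly ?r x - poly (smult ?a \<alpha>) x * v = ?a * (poly q x - poly \<alpha> x * v) - poly ?m x * poly p x"
        by (simp add: algebra_simps)
      also have "\<dots> \<in> P" using q(4) p(2) by blast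
      finally have "poly ?r x \<in> P" using emin'[OF r \<beta>] by blast
      then have "?a * poly q x \<in> P"
        using ideal_in_add[OF I, of "poly ?r x" "poly ?m x * poly p x"] p(2) by auto
      then show False using prime p(3) q(2) by blast
    qed
    \<comment> \<open>The remainder is again a multiple of \<open>v\<close> modulo \<open>P\<close>,
      so minimality of \<open>e\<close> puts its value into \<open>P\<close>, and hence also that of
      \<open>q'\<close>. As \<open>e > 0\<close>, the cofactor has at most \<open>d\<close>
      coefficients, so all of them lie in \<open>P\<close>; comparing coefficients at
      \<open>d\<close> then contradicts \<open>coeff p d \<notin> P\<close>.\<close>
    obtain k q' r where *: "q' \<in> pol A (Suc d - e)" "r \<in> pol A e" "smult (w ^ k) p = q * q' + r"
      using pol_pseudo_divide[OF A q(1) p(1)] unfolding w_def by blast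
    let ?\<beta> = "- (q' * \<alpha>)"
    have \<beta>: "\<forall>i. coeff ?\<beta> i \<in> A"
      using coeff_mult_in[OF A, of q' \<alpha>] polD(1)[OF *(1)] q(3) A by (auto intro: subring_uminus)
    have ev: "w ^ k * poly p x = poly q x * poly q' x + poly r x"
      using arg_cong[OF *(3), of "\<lambda>f. poly f x"] by simp
    have "poly r x - poly ?\<beta> x * v = w ^ k * poly p x - poly q' x * (poly q x - poly \<alpha> x * v)"
      unfolding ev by (simp add: algebra_simps)
    also have "\<dots> \<in> P" using p(2) q(4) by blast
    finally have "poly r x \<in> P" using emin'[OF *(2) \<beta>] by blast
    then have "poly q x * poly q' x \<in> P"
      using ev ideal_in_diff[OF I subring_UNIV, of "w ^ k * poly p x" "poly r x"] ideal_in_mult[OF I _ p(2), of "w ^ k"]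
      by simp
    then have "poly q' x \<in> P" using prime q(2) by blast
    then have "\<forall>i. coeff q' i \<in> P" using low[OF *(1)] \<open>e \<noteq> 0\<close> by auto
    then have "coeff (q * q') d \<in> P" by (auto simp: coeff_mult)
    moreover have "coeff r d = 0" using polD(2)[OF *(2)] \<open>e < d\<close> by auto
    moreover have "w ^ k * coeff p d = coeff (q * q') d + coeff r d"
      using arg_cong[OF *(3), of "\<lambda>f. coeff f d"] by simp
    ultimately show False using prime prime_pow[OF wP] p(3) by (metis add.right_neutral)
  qed
  then have "q = [:w:]"
    using polD(2)[OF q(1)] by (intro poly_eqI) (auto simp: coeff_pCons w_def split: nat.split)
  then have w: "w - poly \<alpha> x * v \<in> P" using q(4) by simp

  show ?thesis
  proof (intro bexI[of _ "coeff p d * w"] allI impI)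
    show "coeff p d * w \<in> A - P" using wA wP p(3) prime polD(1)[OF p(1)] A by (auto intro: subring_mult)
    fix \<phi> :: "'r \<Rightarrow> 'k" assume "is_char P A \<phi> \<and> \<phi> (coeff p d * w) \<noteq> 0"
    then have \<phi>: "is_char P A \<phi>" and nz: "\<phi> (coeff p d) \<noteq> 0" "\<phi> w \<noteq> 0"
      using is_charD(3)[of P A \<phi> "coeff p d" w] wA polD(1)[OF p(1)] by auto
    have "degree (map_poly \<phi> p) \<ge> d"
      by (rule le_degree) (simp add: coeff_map_poly char_0[OF A \<phi>] nz)
    then obtain \<xi> where \<xi>: "poly (map_poly \<phi> p) \<xi> = 0"
      using alg_closed_imp_poly_has_root[of "map_poly \<phi> p"] \<open>d > 0\<close> by auto
    \<comment> \<open>Reduction by \<open>p\<close> lowers the number of coefficients at the cost of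
      the factor \<open>coeff p d\<close>, which \<phi> does not kill and which can therefore be
      cancelled afterwards. Below \<open>d\<close> all coefficients lie in \<open>P\<close>, where
      \<phi> is 0.\<close>
    have van: "poly (map_poly \<phi> g) \<xi> = 0" if "g \<in> pol A N" "poly g x \<in> P" for g N
      using that
    proof (induction N arbitrary: g)
      case 0
      then have "g = 0" using polD(2)[OF 0(1)] by (auto simp: poly_eq_iff)
      then show ?case by simp
    next
      case (Suc N)
      show ?case
      proof (cases "d \<le> N")
        case False
        then have "\<forall>i. coeff g i \<in> P" using low[OF Suc.prems(1)] Suc.prems(2) by auto
        then have "map_poly \<phi> g = 0"
          by (intro poly_eqI) (auto simp: coeff_map_poly char_0[OF A \<phi>] intro!: is_charD(4)[OF \<phi>] polD(1)[OF Suc.prems(1)])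
        then show ?thesis by simp
      next
        case True
        let ?a = "[:coeff p d:]" and ?m = "monom (coeff g N) (N - d)"
        have cA: "\<forall>i. coeff ?a i \<in> A" "\<forall>i. coeff ?m i \<in> A" "\<forall>i. coeff g i \<in> A" "\<forall>i. coeff p i \<in> A"
          using A polD(1)[OF p(1)] polD(1)[OF Suc.prems(1)]
          by (auto simp: coeff_pCons subring_0 split: nat.split)
        have cA': "\<forall>i. coeff (?a * g) i \<in> A" "\<forall>i. coeff (?m * p) i \<in> A" using cA coeff_mult_in[OF A] by blast+
        have r: "?a * g - ?m * p \<in> pol A N" using pol_reduce[OF A p(1) Suc.prems(1) True] by simp
        have "poly (?a * g - ?m * p) x \<in> P" using Suc.prems(2) p(2) by (auto simp: algebra_simps)
        then have "poly (map_poly \<phi> (?a * g - ?m * p)) \<xi> = 0" using Suc.IH[OF r] by blast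
        moreover have "map_poly \<phi> (?a * g - ?m * p) = map_poly \<phi> ?a * map_poly \<phi> g - map_poly \<phi> ?m * map_poly \<phi> p"
          using cA cA' map_poly_char_diff[OF A \<phi>] map_poly_char_mult[OF A \<phi>] by metis
        ultimately have "\<phi> (coeff p d) * poly (map_poly \<phi> g) \<xi> = 0"
          using \<xi> by (simp add: map_poly_pCons char_0[OF A \<phi>])
        then show ?thesis using nz by simp
      qed
    qed
    then have "\<And>g. \<forall>i. coeff g i \<in> A \<Longrightarrow> poly g x \<in> P \<Longrightarrow> poly (map_poly \<phi> g) \<xi> = 0" using pol_exists by blast
    from char_extend_at[OF A \<phi> I this]
    obtain \<psi> where \<psi>: "is_char P (adj A x) \<psi>"
      and ext: "\<And>p. \<forall>i. coeff p i \<in> A \<Longrightarrow> \<psi> (poly p x) = poly (map_poly \<phi> p) \<xi>" by blast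
    have res: "\<psi> a = \<phi> a" if "a \<in> A" for a
      using ext[of "[:a:]"] that A by (auto simp: coeff_pCons subring_0 map_poly_pCons char_0[OF A \<phi>] split: nat.split)
    \<comment> \<open>As \<open>w\<close> is a multiple of \<open>v\<close> modulo \<open>P\<close>,
      the value 0 at \<open>v\<close> would force \<phi> to vanish at \<open>w\<close>.\<close>
    have "\<psi> v \<noteq> 0"
    proof
      assume v0: "\<psi> v = 0"
      have c: "\<forall>i. coeff (\<alpha> * h) i \<in> A" "\<forall>i. coeff ([:w:] - \<alpha> * h) i \<in> A" "\<forall>i. coeff [:w:] i \<in> A"
        using coeff_mult_in[OF A q(3) h(2)] wA A by (auto simp: coeff_pCons subring_0 subring_uminus intro: subring_diff split: nat.split)
      have "\<psi> (poly ([:w:] - \<alpha> * h) x) = 0"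
      proof (rule is_charD(4)[OF \<psi>])
        show "poly ([:w:] - \<alpha> * h) x \<in> adj A x" using c(2) unfolding adj_def by blast
        show "poly ([:w:] - \<alpha> * h) x \<in> P" using w h(1) by simp
      qed
      then have "poly (map_poly \<phi> ([:w:] - \<alpha> * h)) \<xi> = 0" using ext[OF c(2)] by simp
      moreover have "map_poly \<phi> ([:w:] - \<alpha> * h) = [:\<phi> w:] - map_poly \<phi> \<alpha> * map_poly \<phi> h"
        using map_poly_char_diff[OF A \<phi> c(3,1)] map_poly_char_mult[OF A \<phi> q(3) h(2)]
        by (simp add: map_poly_pCons char_0[OF A \<phi>])
      ultimately show False using nz v0 ext[OF h(2)] h(1) by simp
    qed
    then show "\<exists>\<psi>. is_char P (adj A x) \<psi> \<and> (\<forall>a\<in>A. \<psi> a = \<phi> a) \<and> \<psi> v \<noteq> 0" using \<psi> res by blast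
  qed
qed

text \<open>With no nontrivial relation modulo \<open>P\<close>, the image \<xi> of \<open>x\<close>
  is free, since \<phi> turns every relation into the zero polynomial. It only has to avoid the
  roots of the image of \<open>h\<close>, which is nonzero as soon as \<phi> does not kill one
  chosen coefficient of \<open>h\<close>; that coefficient is \<open>u\<close>.\<close>

lemma char_extension_transcendental:
  fixes A P :: "'r::comm_ring_1 set"
  assumes A: "subring A" and I: "ideal_in UNIV P" and v: "v \<in> adj A x" "v \<notin> P"
    and trans: "\<And>g i. \<forall>i. coeff g i \<in> A \<Longrightarrow> poly g x \<in> P \<Longrightarrow> coeff g i \<in> P"
  shows "\<exists>u\<in>A - P. \<forall>\<phi> :: 'r \<Rightarrow> 'k::alg_closed_field. is_char P A \<phi> \<and> \<phi> u \<noteq> 0 \<longrightarrow>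
           (\<exists>\<psi>. is_char P (adj A x) \<psi> \<and> (\<forall>a\<in>A. \<psi> a = \<phi> a) \<and> \<psi> v \<noteq> 0)"
proof -
  obtain h where h: "v = poly h x" "\<forall>i. coeff h i \<in> A" using v(1) unfolding adj_def by blast
  have "\<exists>i. coeff h i \<notin> P"
  proof (rule ccontr)
    assume "\<not> ?thesis"
    then have "poly h x \<in> P" unfolding poly_altdef
      by (intro ideal_in_sum[OF I]) (metis UNIV_I ideal_in_mult[OF I] mult.commute)
    then show False using v h by simp
  qed
  then obtain i where i: "coeff h i \<notin> P" by blast
  show ?thesis
  proof (intro bexI[of _ "coeff h i"] allI impI)
    show "coeff h i \<in> A - P" using h i by blast
    fix \<phi> :: "'r \<Rightarrow> 'k" assume "is_char P A \<phi> \<and> \<phi> (coeff h i) \<noteq> 0"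
    then have \<phi>: "is_char P A \<phi>" and nz: "\<phi> (coeff h i) \<noteq> 0" by auto
    then have "coeff (map_poly \<phi> h) i \<noteq> 0" by (simp add: coeff_map_poly char_0[OF A \<phi>])
    then have "map_poly \<phi> h \<noteq> 0" by auto
    then obtain \<xi> where \<xi>: "poly (map_poly \<phi> h) \<xi> \<noteq> 0" using alg_closed_exists_nonroot by blast
    have "poly (map_poly \<phi> g) \<xi> = 0" if g: "\<forall>i. coeff g i \<in> A" "poly g x \<in> P" for g
    proof -
      have "map_poly \<phi> g = 0"
        by (intro poly_eqI) (use g trans in \<open>auto simp: coeff_map_poly char_0[OF A \<phi>] intro!: is_charD(4)[OF \<phi>]\<close>)
      then show ?thesis by simp
    qed
    from char_extend_at[OF A \<phi> I this]
    obtain \<psi> where \<psi>: "is_char P (adj A x) \<psi>"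
      and ext: "\<And>p. \<forall>i. coeff p i \<in> A \<Longrightarrow> \<psi> (poly p x) = poly (map_poly \<phi> p) \<xi>" by blast
    have res: "\<psi> a = \<phi> a" if "a \<in> A" for a
      using ext[of "[:a:]"] that A by (auto simp: coeff_pCons subring_0 map_poly_pCons char_0[OF A \<phi>] split: nat.split)
    show "\<exists>\<psi>. is_char P (adj A x) \<psi> \<and> (\<forall>a\<in>A. \<psi> a = \<phi> a) \<and> \<psi> v \<noteq> 0"
      using \<psi> res ext[OF h(2)] h(1) \<xi> by auto
  qed
qed

section \<open>The residue field of a maximal ideal\<close>

lemma adj_contains: "subring A \<Longrightarrow> A \<subseteq> adj A x"
proof
  fix a assume "subring A" "a \<in> A"
  then have "poly [:a:] x \<in> adj A x"
    unfolding adj_def by (intro CollectI exI[of _ "[:a:]"]) (auto simp: coeff_pCons subring_0 split: nat.split)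
  then show "a \<in> adj A x" by simp
qed

lemma adj_generator: "subring A \<Longrightarrow> x \<in> adj A x"
proof -
  assume "subring A"
  then have "poly [:0, 1:] x \<in> adj A x"
    unfolding adj_def
    by (intro CollectI exI[of _ "[:0, 1:]"]) (auto simp: coeff_pCons subring_0 subring_1 split: nat.split)
  then show ?thesis by simp
qed

lemma subring_adj:
  assumes A: "subring A"
  shows "subring (adj A x)"
  unfolding subring_def
proof (intro conjI ballI)
  show "1 \<in> adj A x" using adj_contains[OF A] subring_1[OF A] by blast
  fix a b assume "a \<in> adj A x" "b \<in> adj A x"
  then obtain p q where pq: "a = poly p x" "\<forall>i. coeff p i \<in> A" "b = poly q x" "\<forall>i. coeff q i \<in> A"
    unfolding adj_def by auto
  have "\<forall>i. coeff (p + q) i \<in> A" "\<forall>i. coeff (p - q) i \<in> A" "\<forall>i. coeff (p * q) i \<in> A"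
    using pq A coeff_mult_in[OF A] by (auto intro: subring_add subring_diff)
  moreover have "a + b = poly (p + q) x" "a - b = poly (p - q) x" "a * b = poly (p * q) x"
    using pq by auto
  ultimately show "a + b \<in> adj A x" "a - b \<in> adj A x" "a * b \<in> adj A x"
    unfolding adj_def by blast+
qed

lemma char_extension:
  fixes A P :: "'r::comm_ring_1 set"
  assumes "subring A" "prime_ideal P" "v \<in> adj A x" "v \<notin> P"
  shows "\<exists>u\<in>A - P. \<forall>\<phi> :: 'r \<Rightarrow> 'k::alg_closed_field. is_char P A \<phi> \<and> \<phi> u \<noteq> 0 \<longrightarrow>
           (\<exists>\<psi>. is_char P (adj A x) \<psi> \<and> (\<forall>a\<in>A. \<psi> a = \<phi> a) \<and> \<psi> v \<noteq> 0)"
proof (cases "\<exists>g j. (\<forall>i. coeff g i \<in> A) \<and> poly g x \<in> P \<and> coeff g j \<notin> P")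
  case True
  then obtain g j where "\<forall>i. coeff g i \<in> A" "poly g x \<in> P" "coeff g j \<notin> P" by blast
  from char_extension_algebraic[OF assms this] show ?thesis .
next
  case False
  have "ideal_in UNIV P" using assms(2) by (simp add: prime_ideal_def)
  from char_extension_transcendental[OF assms(1) this assms(3,4)] False show ?thesis by blast
qed

section \<open>The weak Nullstellensatz along a tower of generators\<close>

fun tower :: "'r::comm_ring_1 set \<Rightarrow> (nat \<Rightarrow> 'r) \<Rightarrow> nat \<Rightarrow> 'r set" where
  "tower A x 0 = A"
| "tower A x (Suc i) = adj (tower A x i) (x i)"

lemma subring_tower: "subring A \<Longrightarrow> subring (tower A x i)"
  by (induction i) (auto intro: subring_adj)

lemma tower_mono: "subring A \<Longrightarrow> i \<le> j \<Longrightarrow> tower A x i \<subseteq> tower A x j"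
  by (rule lift_Suc_mono_le[of "tower A x"]) (simp_all add: adj_contains subring_tower)

lemma tower_generator:
  assumes "subring A" "i < n"
  shows "x i \<in> tower A x n"
  using adj_generator[OF subring_tower[OF assms(1)], of "x i" x i] tower_mono[of A "Suc i" n x] assms by auto

lemma subring_prod: "subring S \<Longrightarrow> (\<And>i. i \<in> I \<Longrightarrow> f i \<in> S) \<Longrightarrow> prod f I \<in> S"
  by (induction I rule: infinite_finite_induct) (auto intro: subring_1 subring_mult)

locale alg_struct =
  fixes \<iota> :: "'k::field \<Rightarrow> 'r::comm_ring_1"
  assumes iota: "inj_ring_hom \<iota>"
begin

lemma iota_1: "\<iota> 1 = 1" and iota_add: "\<iota> (a + b) = \<iota> a + \<iota> b" and iota_mult: "\<iota> (a * b) = \<iota> a * \<iota> b"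
  and iota_inj: "inj \<iota>"
  using iota unfolding inj_ring_hom_def by auto

lemma iota_0: "\<iota> 0 = 0"
  using iota_add[of 0 0] by simp

lemma iota_uminus: "\<iota> (- a) = - \<iota> a"
  using iota_add[of a "- a"] iota_0 by (simp add: minus_unique)

lemma iota_diff: "\<iota> (a - b) = \<iota> a - \<iota> b"
  using iota_add[of a "- b"] iota_uminus by simp

lemma iota_sum: "\<iota> (sum f I) = (\<Sum>i\<in>I. \<iota> (f i))"
  by (induction I rule: infinite_finite_induct) (auto simp: iota_0 iota_add)

lemma subring_range_iota: "subring (range \<iota>)"
  unfolding subring_def using iota_1 iota_add iota_diff iota_mult by (metis (no_types, lifting) imageE rangeI)

lemma tower_eq_UNIV:
  assumes "generates_alg \<iota> x n"
  shows "tower (range \<iota>) x n = UNIV"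
proof -
  note S = subring_tower[OF subring_range_iota, of x n]
  have "r \<in> tower (range \<iota>) x n" for r
  proof -
    obtain A c where "finite A" "r = poly_expr \<iota> x n A c" using assms unfolding generates_alg_def by blast
    moreover have "\<iota> (c \<alpha>) * monom_in x n \<alpha> \<in> tower (range \<iota>) x n" for \<alpha>
      unfolding monom_in_def
      using tower_mono[OF subring_range_iota, of 0 n x] tower_generator[OF subring_range_iota, of _ n x]
      by (intro subring_mult[OF S] subring_prod[OF S] subring_power[OF S]) auto
    ultimately show ?thesis unfolding poly_expr_def by (auto intro: subring_sum[OF S])
  qed
  then show ?thesis by blast
qed

end

locale alg_closed_struct = alg_struct \<iota> for \<iota> :: "'k::alg_closed_field \<Rightarrow> 'r::comm_ring_1"
begin

text \<open>Keeping \<open>v\<close> nonzero at level \<open>n + 1\<close> requires keeping some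
  other element \<open>u\<close> nonzero at level \<open>n\<close>, so the induction has to range
  over all \<open>v\<close>.\<close>

lemma tower_char:
  assumes P: "prime_ideal P" and "v \<in> tower (range \<iota>) x n" "v \<notin> P"
  shows "\<exists>\<psi>. is_char P (tower (range \<iota>) x n) \<psi> \<and> (\<forall>c. \<psi> (\<iota> c) = c) \<and> \<psi> v \<noteq> 0"
  using assms(2,3)
proof (induction n arbitrary: v)
  case 0
  have I: "ideal_in UNIV P" "P \<noteq> UNIV" using P by (auto simp: prime_ideal_def)
  have one: "1 \<notin> P" using ideal_in_eq_iff[OF I(1) subring_UNIV] I(2) by blast
  let ?\<psi> = "inv \<iota>"
  have inv: "?\<psi> (\<iota> c) = c" for c using iota_inj by simp
  \<comment> \<open>A nonzero scalar is a unit and cannot lie in the proper ideal \<open>P\<close>;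
    hence the inverse of \<iota> respects \<open>P\<close>.\<close>
  have zero: "c = 0" if "\<iota> c \<in> P" for c
  proof (rule ccontr)
    assume "c \<noteq> 0"
    then have "1 = \<iota> (inverse c) * \<iota> c" by (simp flip: iota_mult add: iota_1)
    then show False using ideal_in_mult[OF I(1) _ that, of "\<iota> (inverse c)"] one by simp
  qed
  have "is_char P (range \<iota>) ?\<psi>"
    unfolding is_char_def using inv zero iota_1
    by (auto simp flip: iota_add iota_mult) (metis iota_1 inv)
  moreover have "?\<psi> v \<noteq> 0" using 0 inv iota_0 ideal_in_0[OF I(1)] by auto
  ultimately show ?case using inv by auto
next
  case (Suc n)
  let ?A = "tower (range \<iota>) x n"
  obtain u where u: "u \<in> ?A" "u \<notin> P" and
    ext: "\<And>\<phi> :: 'r \<Rightarrow> 'k. is_char P ?A \<phi> \<Longrightarrow> \<phi> u \<noteq> 0 \<Longrightarrow>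
           (\<exists>\<psi>. is_char P (adj ?A (x n)) \<psi> \<and> (\<forall>a\<in>?A. \<psi> a = \<phi> a) \<and> \<psi> v \<noteq> 0)"
    using char_extension[OF subring_tower[OF subring_range_iota] P, of v x n "x n"] Suc.prems by auto
  obtain \<phi> where \<phi>: "is_char P ?A \<phi>" "\<forall>c. \<phi> (\<iota> c) = c" "\<phi> u \<noteq> 0" using Suc.IH[OF u] by blast
  have "range \<iota> \<subseteq> ?A" using tower_mono[OF subring_range_iota, of 0 n x] by auto
  then show ?case using ext[OF \<phi>(1,3)] \<phi>(2) by (metis (no_types, opaque_lifting) range_subsetD tower.simps(2))
qed

text \<open>Asking only that \<open>1\<close> stay nonzero turns the tower statement into the
  existence of a k-point of \<open>R\<close> at which all of \<open>P\<close> vanishes.\<close>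

lemma weak_nullstellensatz:
  assumes P: "prime_ideal P" and "fin_gen_alg \<iota>"
  shows "\<exists>\<psi>. is_char P UNIV \<psi> \<and> (\<forall>c. \<psi> (\<iota> c) = c)"
proof -
  obtain x n where g: "generates_alg \<iota> x n" using assms(2) unfolding fin_gen_alg_def by blast
  have "1 \<notin> P" using P ideal_in_eq_iff[of UNIV P] subring_UNIV by (auto simp: prime_ideal_def)
  then show ?thesis using tower_char[OF P, of 1 x n] tower_eq_UNIV[OF g] by auto
qed

end

section \<open>Finiteness over a subring and Nakayama's lemma\<close>

inductive_set sspan :: "'r::comm_ring_1 set \<Rightarrow> 'r set \<Rightarrow> 'r set" for S F where
  zero: "0 \<in> sspan S F"
| step: "a \<in> S \<Longrightarrow> f \<in> F \<Longrightarrow> u \<in> sspan S F \<Longrightarrow> a * f + u \<in> sspan S F"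

lemma sspan_base: "subring S \<Longrightarrow> f \<in> F \<Longrightarrow> f \<in> sspan S F"
  using sspan.step[of 1 S f F 0] by (simp add: subring_1 sspan.zero)

lemma sspan_add: "u \<in> sspan S F \<Longrightarrow> w \<in> sspan S F \<Longrightarrow> u + w \<in> sspan S F"
  by (induction rule: sspan.induct) (auto simp: add.assoc intro: sspan.intros)

lemma sspan_mult:
  assumes "subring S" "u \<in> sspan S F" "a \<in> S"
  shows "a * u \<in> sspan S F"
  using assms(2)
proof (induction rule: sspan.induct)
  case (step b f u)
  have "(a * b) * f + a * u \<in> sspan S F" using step assms by (auto intro!: sspan.step subring_mult)
  then show ?case by (simp add: algebra_simps)
qed (auto intro: sspan.intros)

lemma sspan_sum: "(\<And>i. i \<in> I \<Longrightarrow> f i \<in> sspan S F) \<Longrightarrow> sum f I \<in> sspan S F"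
  by (induction I rule: infinite_finite_induct) (auto intro: sspan.zero sspan_add)

lemma sspan_mult_right:
  assumes "subring S" "u \<in> sspan S F" "\<And>f. f \<in> F \<Longrightarrow> f * w \<in> sspan S G"
  shows "u * w \<in> sspan S G"
  using assms(2)
proof (induction rule: sspan.induct)
  case (step a f u)
  then show ?case using assms sspan_mult[of S "f * w" G a] by (auto simp: algebra_simps intro!: sspan_add)
qed (auto intro: sspan.zero)

lemma sspan_finiteD:
  assumes S: "subring S" and F: "finite F" and "u \<in> sspan S F"
  shows "\<exists>a. (\<forall>f. a f \<in> S) \<and> u = (\<Sum>f\<in>F. a f * f)"
  using assms(3)
proof (induction rule: sspan.induct)
  case zero
  then show ?case by (intro exI[of _ "\<lambda>_. 0"]) (auto simp: subring_0[OF S])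
next
  case (step b f u)
  then obtain a where a: "\<forall>f. a f \<in> S" "u = (\<Sum>f\<in>F. a f * f)" by blast
  have "(\<Sum>g\<in>F. (a g + (if g = f then b else 0)) * g) = u + (\<Sum>g\<in>F. if g = f then b * f else 0)"
    unfolding a(2) sum.distrib[symmetric] by (rule sum.cong) (auto simp: algebra_simps)
  also have "\<dots> = b * f + u" using F step.hyps by (simp add: sum.delta)
  finally show ?case
    using a(1) step.hyps S
    by (intro exI[of _ "\<lambda>g. a g + (if g = f then b else 0)"]) (auto intro: subring_add subring_0)
qed

text \<open>The monic equation rewrites the power \<open>degree p\<close> through lower ones;
  multiplied by \<open>r ^ (e - degree p)\<close> it lowers all exponents below \<open>e\<close>,
  hence the strong induction.\<close>

lemma integral_power_sspan:
  assumes S: "subring S" and p: "lead_coeff p = 1" "\<forall>i. coeff p i \<in> S" "poly p r = 0"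
  shows "r ^ e \<in> sspan S ((\<lambda>i. r ^ i) ` {..<degree p})"
proof (induction e rule: less_induct)
  case (less e)
  let ?d = "degree p"
  show ?case
  proof (cases "e < ?d")
    case True
    then show ?thesis by (intro sspan_base[OF S]) auto
  next
    case False
    have "0 = (\<Sum>i\<le>?d. coeff p i * r ^ i)" using p(3) by (simp add: poly_altdef)
    also have "\<dots> = (\<Sum>i<?d. coeff p i * r ^ i) + r ^ ?d"
      using p(1) by (simp flip: lessThan_Suc_atMost)
    finally have rd: "r ^ ?d = (\<Sum>i<?d. - coeff p i * r ^ i)" by (simp add: sum_negf add_eq_0_iff)
    have "r ^ e = r ^ ?d * r ^ (e - ?d)" using False by (simp flip: power_add)
    also have "\<dots> = (\<Sum>i<?d. - coeff p i * r ^ (i + (e - ?d)))"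
      unfolding rd sum_distrib_right by (simp add: power_add algebra_simps)
    also have "\<dots> \<in> sspan S ((\<lambda>i. r ^ i) ` {..<?d})"
      using p(2) S False by (intro sspan_sum sspan_mult[OF S] less.IH) (auto intro: subring_uminus)
    finally show ?thesis .
  qed
qed

text \<open>Monomials are spanned by products of bounded powers of the generators, one variable at a
  time; scalars from k are absorbed because \<iota> maps into \<open>S\<close>.\<close>

lemma (in alg_struct) finite_over_subring:
  assumes S: "subring S" "range \<iota> \<subseteq> S" and g: "fin_gen_alg \<iota>" and int: "integral_over S"
  shows "\<exists>F. finite F \<and> sspan S F = UNIV"
proof -
  obtain x n where g: "generates_alg \<iota> x n" using assms(3) unfolding fin_gen_alg_def by blast
  have "\<exists>F. finite F \<and> (\<forall>\<alpha>. monom_in x n \<alpha> \<in> sspan S F)"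
  proof (induction n)
    case 0
    then show ?case using sspan_base[OF S(1), of 1 "{1}"] by (intro exI[of _ "{1}"]) (auto simp: monom_in_def)
  next
    case (Suc n)
    then obtain F where F: "finite F" "\<And>\<alpha>. monom_in x n \<alpha> \<in> sspan S F" by blast
    obtain p where p: "lead_coeff p = 1" "\<forall>i. coeff p i \<in> S" "poly p (x n) = 0"
      using int unfolding integral_over_def by blast
    let ?G = "(\<lambda>i. x n ^ i) ` {..<degree p}"
    let ?H = "(\<lambda>(f, g). f * g) ` (F \<times> ?G)"
    have "monom_in x (Suc n) \<alpha> \<in> sspan S ?H" for \<alpha>
    proof -
      have "f * x n ^ \<alpha> n \<in> sspan S ?H" if f: "f \<in> F" for f
      proof -
        have "x n ^ \<alpha> n * f \<in> sspan S ?H"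
        proof (rule sspan_mult_right[OF S(1) integral_power_sspan[OF S(1) p]])
          fix g assume "g \<in> ?G"
          then have "f * g \<in> ?H" using f by auto
          then show "g * f \<in> sspan S ?H" using sspan_base[OF S(1)] by (simp add: mult.commute)
        qed
        then show ?thesis by (simp add: mult.commute)
      qed
      then have "monom_in x n \<alpha> * x n ^ \<alpha> n \<in> sspan S ?H" by (rule sspan_mult_right[OF S(1) F(2)])
      then show ?thesis by (simp add: monom_in_def)
    qed
    moreover have "finite ?H" using F by auto
    ultimately show ?case by blast
  qed
  then obtain F where F: "finite F" "\<And>\<alpha>. monom_in x n \<alpha> \<in> sspan S F" by blast
  have "r \<in> sspan S F" for r
  proof -
    obtain A c where "r = poly_expr \<iota> x n A c" using g unfolding generates_alg_def by blast
    then show ?thesis unfolding poly_expr_def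
      using S by (auto intro!: sspan_sum sspan_mult[OF S(1)] F(2))
  qed
  then show ?thesis using F(1) by blast
qed

text \<open>Nakayama without determinants: the relations are solved for one generator, which is then
  substituted into the others. Substitution multiplies a relation by an element congruent to 1
  modulo \<open>I\<close>, so the hypothesis allows such multipliers \<open>e\<close> in front of
  each generator from the start.\<close>

lemma nakayama_elimination:
  fixes S I F :: "'r::comm_ring_1 set"
  assumes S: "subring S" and I: "ideal_in S I" and "finite F"
    and "\<forall>f\<in>F. \<exists>e a. 1 - e \<in> I \<and> (\<forall>g. a g \<in> I) \<and> e * f = (\<Sum>g\<in>F. a g * g)"
  shows "\<exists>e. 1 - e \<in> I \<and> (\<forall>f\<in>F. e * f = 0)"
  using assms(3,4)
proof (induction F rule: finite_induct)
  case empty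
  then show ?case using ideal_in_0[OF I] by (intro exI[of _ 1]) auto
next
  case (insert h F)
  have unit_mult: "1 - e * e' \<in> I" if "1 - e \<in> I" "1 - e' \<in> I" for e e'
  proof -
    have "e \<in> S" using subring_diff[OF S subring_1[OF S] ideal_in_subset[OF I that(1)]] by simp
    then have "(1 - e) + e * (1 - e') \<in> I" using that by (intro ideal_in_add[OF I] ideal_in_mult[OF I])
    then show ?thesis by (simp add: algebra_simps)
  qed
  obtain e0 a where a: "1 - e0 \<in> I" "\<forall>g. a g \<in> I" "e0 * h = (\<Sum>g\<in>insert h F. a g * g)"
    using insert.prems by blast
  \<comment> \<open>Moving the \<open>h\<close>-term of its own relation to the left changes the
    multiplier only by an element of \<open>I\<close>.\<close>
  define eh where "eh = e0 - a h"
  have eh: "1 - eh \<in> I" using ideal_in_add[OF I a(1), of "a h"] a(2) by (simp add: eh_def algebra_simps)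
  have ehS: "eh \<in> S" using subring_diff[OF S subring_1[OF S] ideal_in_subset[OF I eh]] by simp
  have h: "eh * h = (\<Sum>g\<in>F. a g * g)"
    using a(3) insert.hyps by (simp add: eh_def algebra_simps)
  have "\<forall>f\<in>F. \<exists>e b. 1 - e \<in> I \<and> (\<forall>g. b g \<in> I) \<and> e * f = (\<Sum>g\<in>F. b g * g)"
  proof
    fix f assume "f \<in> F"
    then obtain e b where b: "1 - e \<in> I" "\<forall>g. b g \<in> I" "e * f = (\<Sum>g\<in>insert h F. b g * g)"
      using insert.prems by blast
    have "(eh * e) * f = b h * (eh * h) + eh * (\<Sum>g\<in>F. b g * g)"
      using b(3) insert.hyps by (simp add: mult.assoc distrib_left mult.left_commute)
    also have "\<dots> = (\<Sum>g\<in>F. (b h * a g + eh * b g) * g)"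
      unfolding h by (simp add: sum_distrib_left sum.distrib algebra_simps)
    finally show "\<exists>e b. 1 - e \<in> I \<and> (\<forall>g. b g \<in> I) \<and> e * f = (\<Sum>g\<in>F. b g * g)"
      using a(2) b(2) unit_mult[OF eh b(1)] ehS ideal_in_subset[OF I]
      by (intro exI[of _ "eh * e"] exI[of _ "\<lambda>g. b h * a g + eh * b g"])
        (auto intro!: ideal_in_add[OF I] ideal_in_mult[OF I])
  qed
  then obtain e where e: "1 - e \<in> I" "\<forall>f\<in>F. e * f = 0" using insert.IH by blast
  have "(e * eh) * h = (\<Sum>g\<in>F. a g * (e * g))" by (simp add: mult.assoc h sum_distrib_left mult.left_commute)
  also have "\<dots> = 0" using e(2) by simp
  finally have "(e * eh) * h = 0" .
  moreover have "(e * eh) * f = 0" if "f \<in> F" for f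
    using e(2) that by (metis mult.assoc mult.commute mult_zero_right)
  ultimately show ?case using unit_mult[OF e(1) eh] by (intro exI[of _ "e * eh"]) auto
qed

lemma ideal_in_gen_ideal:
  assumes S: "subring S" and y: "\<forall>i<m. y i \<in> S"
  shows "ideal_in S (gen_ideal_in S y m)"
  unfolding ideal_in_def
proof (intro conjI ballI)
  show "gen_ideal_in S y m \<subseteq> S"
    using y by (auto simp: gen_ideal_in_def intro!: subring_sum[OF S] subring_mult[OF S])
  show "0 \<in> gen_ideal_in S y m"
    unfolding gen_ideal_in_def by (intro CollectI exI[of _ "\<lambda>_. 0"]) (auto simp: subring_0[OF S])
  fix a assume "a \<in> gen_ideal_in S y m"
  then obtain \<alpha> where \<alpha>: "a = (\<Sum>i<m. \<alpha> i * y i)" "\<forall>i<m. \<alpha> i \<in> S" unfolding gen_ideal_in_def by blast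
  show "a + b \<in> gen_ideal_in S y m" if b: "b \<in> gen_ideal_in S y m" for b
  proof -
    obtain \<beta> where \<beta>: "b = (\<Sum>i<m. \<beta> i * y i)" "\<forall>i<m. \<beta> i \<in> S" using b unfolding gen_ideal_in_def by blast
    then show ?thesis unfolding gen_ideal_in_def using \<alpha>
      by (intro CollectI exI[of _ "\<lambda>i. \<alpha> i + \<beta> i"]) (auto simp: algebra_simps sum.distrib intro: subring_add[OF S])
  qed
  show "r * a \<in> gen_ideal_in S y m" if "r \<in> S" for r
    unfolding gen_ideal_in_def using \<alpha> that
    by (intro CollectI exI[of _ "\<lambda>i. r * \<alpha> i"]) (auto simp: sum_distrib_left mult.assoc intro: subring_mult[OF S])
qed

text \<open>If the \<open>y i\<close> generate the unit ideal of the large ring, each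
  \<open>f\<close> in \<open>F\<close> is the sum of the \<open>y i * (r i * f)\<close>; expanding
  \<open>r i * f\<close> over \<open>F\<close> gives relations with coefficients in the small ideal,
  as Nakayama requires.\<close>

lemma extended_ideal_proper:
  assumes S: "subring S" and F: "finite F" "sspan S F = UNIV" and y: "\<forall>i<m. y i \<in> S"
    and one: "1 \<in> gen_ideal_in UNIV y m"
  shows "1 \<in> gen_ideal_in S y m"
proof -
  let ?I = "gen_ideal_in S y m"
  note I = ideal_in_gen_ideal[OF S y]
  obtain r where r: "1 = (\<Sum>i<m. r i * y i)" using one unfolding gen_ideal_in_def by blast
  have "\<forall>f\<in>F. \<exists>e a. 1 - e \<in> ?I \<and> (\<forall>g. a g \<in> ?I) \<and> e * f = (\<Sum>g\<in>F. a g * g)"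
  proof
    fix f assume "f \<in> F"
    have "\<exists>b. (\<forall>g. b g \<in> S) \<and> r i * f = (\<Sum>g\<in>F. b g * g)" for i
      using sspan_finiteD[OF S F(1)] F(2) by blast
    then obtain b where b: "\<And>i g. b i g \<in> S" "\<And>i. r i * f = (\<Sum>g\<in>F. b i g * g)" by metis
    have "1 * f = (\<Sum>i<m. y i * (r i * f))"
      by (subst r, subst sum_distrib_right) (simp add: mult_ac)
    also have "\<dots> = (\<Sum>i<m. \<Sum>g\<in>F. b i g * y i * g)" unfolding b(2) by (simp add: sum_distrib_left mult_ac)
    also have "\<dots> = (\<Sum>g\<in>F. (\<Sum>i<m. b i g * y i) * g)" by (subst sum.swap) (simp add: sum_distrib_right)
    finally show "\<exists>e a. 1 - e \<in> ?I \<and> (\<forall>g. a g \<in> ?I) \<and> e * f = (\<Sum>g\<in>F. a g * g)"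
      using b(1) ideal_in_0[OF I] unfolding gen_ideal_in_def
      by (intro exI[of _ 1] exI[of _ "\<lambda>g. \<Sum>i<m. b i g * y i"]) auto
  qed
  from nakayama_elimination[OF S I F(1) this]
  obtain e where e: "1 - e \<in> ?I" "\<forall>f\<in>F. e * f = 0" by blast
  \<comment> \<open>\<open>e\<close> kills all of \<open>F\<close>, and \<open>1\<close> is a
    combination of \<open>F\<close>, so \<open>e\<close> itself is 0.\<close>
  obtain a where "1 = (\<Sum>f\<in>F. a f * f)" using sspan_finiteD[OF S F(1), of 1] F(2) by blast
  then have "e = (\<Sum>f\<in>F. a f * (e * f))" by (metis (no_types, lifting) mult.left_commute mult.right_neutral sum.cong sum_distrib_left)
  then have "e = 0" using e(2) by simp
  then show ?thesis using e(1) by simp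
qed

text \<open>The k-point is taken on the large ring, where finite generation is available. Its kernel
  on \<open>S\<close> contains the maximal ideal and omits 1, so it equals that ideal, and
  \<open>r\<close> is congruent to its own value.\<close>

lemma (in alg_closed_struct) residue_field:
  assumes S: "subring S" "range \<iota> \<subseteq> S" and g: "fin_gen_alg \<iota>" and int: "integral_over S"
    and y: "\<forall>i<m. y i \<in> S" and mx: "maximal_ideal_in S (gen_ideal_in S y m)" and r: "r \<in> S"
  shows "\<exists>c. r - \<iota> c \<in> gen_ideal_in S y m"
proof -
  let ?I = "gen_ideal_in S y m" and ?J = "gen_ideal_in UNIV y m"
  note I = ideal_in_gen_ideal[OF S(1) y]
  obtain F where "finite F" "sspan S F = UNIV" using finite_over_subring[OF S g int] by blast
  moreover have "1 \<notin> ?I" using mx ideal_in_eq_iff[OF I S(1)] unfolding maximal_ideal_in_def by blast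
  ultimately have "1 \<notin> ?J" using extended_ideal_proper[OF S(1) _ _ y] by blast
  moreover have "ideal_in UNIV ?J" using ideal_in_gen_ideal[OF subring_UNIV] by auto
  ultimately obtain P where P: "maximal_ideal_in UNIV P" "?J \<subseteq> P"
    using exists_maximal_ideal subring_UNIV by blast
  obtain \<psi> where \<psi>: "is_char P UNIV \<psi>" "\<And>c. \<psi> (\<iota> c) = c"
    using weak_nullstellensatz[OF maximal_imp_prime_ideal[OF P(1)] g] by blast
  let ?K = "{a \<in> S. \<psi> a = 0}"
  have "ideal_in S ?K"
    unfolding ideal_in_def
    using is_charD(2,3)[OF \<psi>(1)] char_0[OF subring_UNIV \<psi>(1)] subring_intros[OF S(1)] by auto
  moreover have "?I \<subseteq> ?K"
  proof
    fix a assume a: "a \<in> ?I"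
    then have "a \<in> ?J" unfolding gen_ideal_in_def by auto
    then show "a \<in> ?K" using a ideal_in_subset[OF I] P(2) is_charD(4)[OF \<psi>(1)] by blast
  qed
  moreover have "?K \<noteq> S" using is_charD(1)[OF \<psi>(1)] subring_1[OF S(1)] by force
  ultimately have "?K = ?I" using mx unfolding maximal_ideal_in_def by blast
  moreover have "r - \<iota> (\<psi> r) \<in> ?K"
    using r S \<psi>(2) char_diff[OF subring_UNIV \<psi>(1)] by (auto intro: subring_diff)
  ultimately show ?thesis by blast
qed

section \<open>Triangularization of finite-dimensional quotients\<close>

lemma is_module_iff: "is_module smul \<longleftrightarrow> module smul"
  unfolding is_module_def module_def by metis

lemma quot_triangularizableE:
  assumes "quot_triangularizable \<iota> smul x n Z B"
  obtains s :: nat and b z where "\<forall>j<s. z j \<in> Z"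
    and "\<forall>a. (\<Sum>j<s. smul (\<iota> (a j)) (z j)) \<in> B \<longrightarrow> (\<forall>j<s. a j = 0)"
    and "\<forall>w\<in>Z. \<exists>a. w - (\<Sum>j<s. smul (\<iota> (a j)) (z j)) \<in> B"
    and "\<forall>A c. finite A \<longrightarrow> (\<forall>j<s. \<exists>a. smul (poly_expr \<iota> x n A c) (z j)
            - smul (\<iota> (poly_eval_pt n A c (b j))) (z j) - (\<Sum>i\<in>{j<..<s}. smul (\<iota> (a i)) (z i)) \<in> B)"
  using assms unfolding quot_triangularizable_def by (elim exE conjE) (rule that; assumption)

text \<open>\<open>subspace\<close> and \<open>span\<close> inherited from \<open>module\<close>
  refer to the ring \<open>'r\<close>, so a subspace is an R-submodule; k-linear combinations are
  written through \<iota>.\<close>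

locale alg_module = alg_struct \<iota> + module smul
  for \<iota> :: "'k::field \<Rightarrow> 'r::comm_ring_1" and smul :: "'r \<Rightarrow> 'v::ab_group_add \<Rightarrow> 'v"
begin

lemma submodule_iff: "submodule smul N \<longleftrightarrow> subspace N"
  unfolding submodule_def subspace_def by auto

lemma subspace_cong: "subspace B \<Longrightarrow> u - w \<in> B \<Longrightarrow> u \<in> B \<longleftrightarrow> w \<in> B"
  using subspace_diff[of B u "u - w"] subspace_add[of B "u - w" w] by auto

text \<open>The pairs (r, t) such that \<open>r\<close> acts on \<open>z\<close> as the scalar
  \<open>t\<close> modulo \<open>B\<close> are closed under sums and products, and they contain the
  constants and the pairs (x_i, b_i).\<close>

lemma poly_expr_acts:
  assumes B: "subspace B" and b: "\<And>i. i < n \<Longrightarrow> smul (x i) z - smul (\<iota> (b i)) z \<in> B"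
  shows "smul (poly_expr \<iota> x n A c) z - smul (\<iota> (poly_eval_pt n A c b)) z \<in> B"
proof -
  define E where "E = {(r, t). smul r z - smul (\<iota> t) z \<in> B}"
  have mult: "(r * r', t * t') \<in> E" if "(r, t) \<in> E" "(r', t') \<in> E" for r t r' t'
  proof -
    have "smul r (smul r' z - smul (\<iota> t') z) + smul (\<iota> t') (smul r z - smul (\<iota> t) z) \<in> B"
      using that B by (auto simp: E_def intro!: subspace_add subspace_scale)
    then show ?thesis by (simp add: E_def scale_right_diff_distrib iota_mult mult.commute)
  qed
  have one: "(1, 1) \<in> E" using subspace_0[OF B] by (simp add: E_def iota_1)
  have const: "(\<iota> t, t) \<in> E" for t using subspace_0[OF B] by (simp add: E_def)
  have pow: "(r ^ k, t ^ k) \<in> E" if "(r, t) \<in> E" for r t k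
    by (induction k) (auto intro: one mult that)
  have prd: "(prod f I, prod g I) \<in> E" if "\<And>i. i \<in> I \<Longrightarrow> (f i, g i) \<in> E" for f g and I :: "nat set"
    using that by (induction I rule: infinite_finite_induct) (auto intro: one mult)
  have sm: "(sum f I, sum g I) \<in> E" if "\<And>i. i \<in> I \<Longrightarrow> (f i, g i) \<in> E" for f g and I :: "(nat \<Rightarrow> nat) set"
  proof -
    have "(\<Sum>i\<in>I. smul (f i) z - smul (\<iota> (g i)) z) \<in> B"
      using that by (intro subspace_sum[OF B]) (auto simp: E_def)
    then show ?thesis by (simp add: E_def iota_sum scale_sum_left sum_subtractf)
  qed
  have "(poly_expr \<iota> x n A c, poly_eval_pt n A c b) \<in> E"
    unfolding poly_expr_def poly_eval_pt_def monom_in_def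
    by (intro sm mult const prd pow) (use b in \<open>auto simp: E_def\<close>)
  then show ?thesis by (simp add: E_def)
qed

lemma poly_map_iota_mult:
  "poly (map_poly \<iota> (p * q)) r = poly (map_poly \<iota> p) r * poly (map_poly \<iota> q) r"
proof -
  have "map_poly \<iota> (p * q) = map_poly \<iota> p * map_poly \<iota> q"
    by (rule poly_eqI) (simp add: coeff_map_poly iota_0 coeff_mult iota_sum iota_mult)
  then show ?thesis by simp
qed

end

locale alg_closed_module = alg_closed_struct \<iota> + alg_module \<iota> smul
  for \<iota> :: "'k::alg_closed_field \<Rightarrow> 'r::comm_ring_1" and smul :: "'r \<Rightarrow> 'v::ab_group_add \<Rightarrow> 'v"
begin

text \<open>Linear factors of \<open>p\<close> are split off one at a time. Since \<open>u\<close>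
  itself is not in \<open>B\<close>, some partial product applied to \<open>u\<close> is still
  outside \<open>B\<close> while one more factor sends it into \<open>B\<close>.\<close>

lemma exists_eigenvector:
  assumes B: "subspace B" and U: "subspace U" and u: "u \<in> U" "u \<notin> B"
    and p: "p \<noteq> 0" "smul (poly (map_poly \<iota> p) r) u \<in> B"
  shows "\<exists>w\<in>U - B. \<exists>b. smul r w - smul (\<iota> b) w \<in> B"
  using p
proof (induction "degree p" arbitrary: p)
  case 0
  then obtain c where c: "p = [:c:]" using degree_eq_zeroE by metis
  then have "smul (\<iota> c) u \<in> B" using 0 by (simp add: map_poly_pCons iota_0)
  then have "smul (\<iota> (inverse c)) (smul (\<iota> c) u) \<in> B" by (rule subspace_scale[OF B])
  moreover have "\<iota> (inverse c) * \<iota> c = 1" using 0 c by (simp flip: iota_mult add: iota_1)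
  ultimately show ?case using u by simp
next
  case (Suc d)
  then obtain b where "poly p b = 0" using alg_closed_imp_poly_has_root[of p] by auto
  then obtain q where q: "p = [:- b, 1:] * q" by (auto simp: poly_eq_0_iff_dvd)
  let ?w = "smul (poly (map_poly \<iota> q) r) u"
  have q0: "q \<noteq> 0" using Suc.prems q by auto
  have eig: "smul r ?w - smul (\<iota> b) ?w \<in> B"
  proof -
    have "poly (map_poly \<iota> [:- b, 1:]) r = r - \<iota> b"
      by (simp add: map_poly_pCons iota_0 iota_1 iota_uminus)
    then have "smul (r - \<iota> b) ?w \<in> B"
      using Suc.prems(2) unfolding q poly_map_iota_mult by simp
    then show ?thesis by (simp only: scale_left_diff_distrib)
  qed
  show ?case
  proof (cases "?w \<in> B")
    case True
    have "degree p = 1 + degree q" using q q0 by (simp add: degree_mult_eq del: mult_pCons_left)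
    then show ?thesis using Suc.hyps(1)[of q] Suc.hyps(2) q0 True by auto
  next
    case False
    then show ?thesis using eig subspace_scale[OF U u(1)] by blast
  qed
qed

text \<open>Because \<open>R\<close> is commutative, the eigenspace of one generator modulo
  \<open>B\<close> is an R-submodule, so the next generator acts on it and an eigenvector can be
  sought inside it.\<close>

lemma exists_common_eigenvector:
  fixes x :: "nat \<Rightarrow> 'r"
  assumes B: "subspace B" and Z: "subspace Z" and "\<not> Z \<subseteq> B"
    and p: "\<And>i. i < n \<Longrightarrow> \<exists>p. p \<noteq> 0 \<and> (\<forall>z\<in>Z. smul (poly (map_poly \<iota> p) (x i)) z \<in> B)"
  shows "\<exists>z\<in>Z - B. \<exists>b. \<forall>i<n. smul (x i) z - smul (\<iota> (b i)) z \<in> B"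
proof -
  have "\<exists>U b. subspace U \<and> U \<subseteq> Z \<and> \<not> U \<subseteq> B \<and> (\<forall>i<n. \<forall>z\<in>U. smul (x i) z - smul (\<iota> (b i)) z \<in> B)"
    using p
  proof (induction n)
    case 0
    then show ?case using Z assms(3) by auto
  next
    case (Suc n)
    then obtain U b where U: "subspace U" "U \<subseteq> Z" "\<not> U \<subseteq> B"
      and b: "\<forall>i<n. \<forall>z\<in>U. smul (x i) z - smul (\<iota> (b i)) z \<in> B" by (metis less_Suc_eq)
    obtain p where "p \<noteq> 0" "\<forall>z\<in>Z. smul (poly (map_poly \<iota> p) (x n)) z \<in> B" using Suc.prems[of n] by auto
    moreover obtain u where "u \<in> U" "u \<notin> B" using U by blast
    ultimately obtain w \<beta> where w: "w \<in> U" "w \<notin> B" "smul (x n) w - smul (\<iota> \<beta>) w \<in> B"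
      using exists_eigenvector[OF B U(1)] U(2) by blast
    let ?U = "{z \<in> U. smul (x n) z - smul (\<iota> \<beta>) z \<in> B}"
    have "subspace ?U"
    proof (rule subspaceI)
      show "0 \<in> ?U" using subspace_0[OF U(1)] subspace_0[OF B] by simp
    next
      fix u v assume uv: "u \<in> ?U" "v \<in> ?U"
      have "smul (x n) (u + v) - smul (\<iota> \<beta>) (u + v) =
          (smul (x n) u - smul (\<iota> \<beta>) u) + (smul (x n) v - smul (\<iota> \<beta>) v)"
        by (simp add: scale_right_distrib)
      then show "u + v \<in> ?U" using uv subspace_add[OF U(1)] subspace_add[OF B] by auto
    next
      fix c u assume u: "u \<in> ?U"
      have "smul (x n) (smul c u) - smul (\<iota> \<beta>) (smul c u) = smul c (smul (x n) u - smul (\<iota> \<beta>) u)"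
        by (simp add: scale_right_diff_distrib mult.commute)
      then show "smul c u \<in> ?U" using u subspace_scale[OF U(1)] subspace_scale[OF B] by auto
    qed
    then show ?case using U w b
      by (intro exI[of _ ?U] exI[of _ "b(n := \<beta>)"]) (auto simp: less_Suc_eq)
  qed
  then show ?thesis by blast
qed

lemma triangularizable:
  assumes "finite F" "subspace B" "subspace Z" "generates_alg \<iota> x n"
    and "\<And>i. i < n \<Longrightarrow> \<exists>p. p \<noteq> 0 \<and> (\<forall>z\<in>Z. smul (poly (map_poly \<iota> p) (x i)) z \<in> B)"
    and "\<And>w. w \<in> Z \<Longrightarrow> \<exists>a. w - (\<Sum>f\<in>F. smul (\<iota> (a f)) f) \<in> B"
  shows "quot_triangularizable \<iota> smul x n Z B"
  using assms
proof (induction "card F" arbitrary: F B rule: less_induct)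
  case less
  note B = less.prems(2)
  show ?case
  proof (cases "Z \<subseteq> B")
    case True
    then show ?thesis unfolding quot_triangularizable_def by (intro exI[of _ 0]) auto
  next
    case False
    obtain z b where z: "z \<in> Z" "z \<notin> B" and b: "\<And>i. i < n \<Longrightarrow> smul (x i) z - smul (\<iota> (b i)) z \<in> B"
      using exists_common_eigenvector[OF B less.prems(3) False, of n x] less.prems(5) by blast
    have eig: "smul (poly_expr \<iota> x n A c) z - smul (\<iota> (poly_eval_pt n A c b)) z \<in> B" for A c
      using b by (intro poly_expr_acts[OF B])
    \<comment> \<open>Adding only the k-multiples of \<open>z\<close> yields an R-submodule
      precisely because \<open>z\<close> is an eigenvector of all of \<open>R\<close> modulo
      \<open>B\<close>.\<close>
    define B' where "B' = {w. \<exists>t. w - smul (\<iota> t) z \<in> B}"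
    have BB': "B \<subseteq> B'" unfolding B'_def by (auto intro!: exI[of _ 0] simp: iota_0)
    have B': "subspace B'"
    proof (rule subspaceI)
      show "0 \<in> B'" using BB' subspace_0[OF B] by blast
    next
      fix u v assume "u \<in> B'" "v \<in> B'"
      then obtain s t where "u - smul (\<iota> s) z \<in> B" "v - smul (\<iota> t) z \<in> B" unfolding B'_def by blast
      then have "(u - smul (\<iota> s) z) + (v - smul (\<iota> t) z) \<in> B" by (rule subspace_add[OF B])
      then have "u + v - smul (\<iota> (s + t)) z \<in> B" by (simp add: iota_add scale_left_distrib algebra_simps)
      then show "u + v \<in> B'" unfolding B'_def by blast
    next
      fix r u assume "u \<in> B'"
      then obtain t where t: "u - smul (\<iota> t) z \<in> B" unfolding B'_def by blast
      obtain A c where "r = poly_expr \<iota> x n A c" using less.prems(4) unfolding generates_alg_def by blast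
      then obtain e where e: "smul r z - smul (\<iota> e) z \<in> B" using eig by blast
      have "smul r (u - smul (\<iota> t) z) + smul (\<iota> t) (smul r z - smul (\<iota> e) z) \<in> B"
        using t e by (intro subspace_add[OF B] subspace_scale[OF B])
      then have "smul r u - smul (\<iota> (t * e)) z \<in> B"
        by (simp add: scale_right_diff_distrib iota_mult mult.commute)
      then show "smul r u \<in> B'" unfolding B'_def by blast
    qed
    obtain \<zeta> where \<zeta>: "z - (\<Sum>f\<in>F. smul (\<iota> (\<zeta> f)) f) \<in> B" using less.prems(6)[OF z(1)] by blast
    have "\<exists>f\<in>F. \<zeta> f \<noteq> 0"
    proof (rule ccontr)
      assume "\<not> ?thesis"
      then have "(\<Sum>f\<in>F. smul (\<iota> (\<zeta> f)) f) = 0" by (intro sum.neutral) (auto simp: iota_0)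
      then show False using \<zeta> z by simp
    qed
    \<comment> \<open>Exchange step: \<open>z\<close> involves \<open>g\<close> with a nonzero
      coefficient, so modulo \<open>z\<close> the vector \<open>g\<close> is a combination of the
      others.\<close>
    then obtain g where g: "g \<in> F" "\<zeta> g \<noteq> 0" by blast
    let ?F = "F - {g}"
    have span: "\<exists>a. w - (\<Sum>f\<in>?F. smul (\<iota> (a f)) f) \<in> B'" if w: "w \<in> Z" for w
    proof -
      obtain a where a: "w - (\<Sum>f\<in>F. smul (\<iota> (a f)) f) \<in> B" using less.prems(6)[OF w] by blast
      define t where "t = a g / \<zeta> g"
      have tg: "a g - t * \<zeta> g = 0" using g by (simp add: t_def)
      have "(w - (\<Sum>f\<in>F. smul (\<iota> (a f)) f)) - smul (\<iota> t) (z - (\<Sum>f\<in>F. smul (\<iota> (\<zeta> f)) f)) \<in> B"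
        by (rule subspace_diff[OF B a subspace_scale[OF B \<zeta>]])
      also have "(w - (\<Sum>f\<in>F. smul (\<iota> (a f)) f)) - smul (\<iota> t) (z - (\<Sum>f\<in>F. smul (\<iota> (\<zeta> f)) f)) =
          w - (\<Sum>f\<in>F. smul (\<iota> (a f - t * \<zeta> f)) f) - smul (\<iota> t) z"
        by (simp add: scale_right_diff_distrib scale_sum_right iota_diff scale_left_diff_distrib
            sum_subtractf iota_mult algebra_simps)
      also have "(\<Sum>f\<in>F. smul (\<iota> (a f - t * \<zeta> f)) f) = (\<Sum>f\<in>?F. smul (\<iota> (a f - t * \<zeta> f)) f)"
        using sum.remove[OF less.prems(1) g(1), of "\<lambda>f. smul (\<iota> (a f - t * \<zeta> f)) f"] tg by (simp add: iota_0)
      finally show ?thesis unfolding B'_def by (intro exI[of _ "\<lambda>f. a f - t * \<zeta> f"]) blast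
    qed
    have "quot_triangularizable \<iota> smul x n Z B'"
    proof (rule less.hyps[OF _ _ B' less.prems(3,4) _ span])
      show "card ?F < card F" using card_Diff1_less[OF less.prems(1) g(1)] .
      show "\<exists>p. p \<noteq> 0 \<and> (\<forall>z\<in>Z. smul (poly (map_poly \<iota> p) (x i)) z \<in> B')" if "i < n" for i
        using less.prems(5)[OF that] BB' by blast
    qed (use less.prems(1) in auto)
    then obtain s :: nat and \<beta> v where v: "\<forall>j<s. v j \<in> Z"
      and ind: "\<forall>a. (\<Sum>j<s. smul (\<iota> (a j)) (v j)) \<in> B' \<longrightarrow> (\<forall>j<s. a j = 0)"
      and gen: "\<forall>w\<in>Z. \<exists>a. w - (\<Sum>j<s. smul (\<iota> (a j)) (v j)) \<in> B'"
      and tri: "\<forall>A c. finite A \<longrightarrow> (\<forall>j<s. \<exists>a. smul (poly_expr \<iota> x n A c) (v j)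
            - smul (\<iota> (poly_eval_pt n A c (\<beta> j))) (v j) - (\<Sum>i\<in>{j<..<s}. smul (\<iota> (a i)) (v i)) \<in> B')"
      by (rule quot_triangularizableE)
    \<comment> \<open>Lower triangularity sums over later indices, so the eigenvector found first
      takes the last position; its multiple in \<open>B'\<close> becomes the entry at index
      \<open>s\<close>.\<close>
    let ?v = "v(s := z)" and ?\<beta> = "\<beta>(s := b)"
    have sum_s: "(\<Sum>j<Suc s. smul (\<iota> (a j)) (?v j)) = (\<Sum>j<s. smul (\<iota> (a j)) (v j)) + smul (\<iota> (a s)) z" for a
      by simp
    show ?thesis
      unfolding quot_triangularizable_def
    proof (intro exI[of _ "Suc s"] exI[of _ ?\<beta>] exI[of _ ?v] conjI allI impI ballI)
      show "?v j \<in> Z" if "j < Suc s" for j using that v z by (auto simp: less_Suc_eq)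
    next
      fix a j assume a: "(\<Sum>j<Suc s. smul (\<iota> (a j)) (?v j)) \<in> B" and j: "j < Suc s"
      have "(\<Sum>j<s. smul (\<iota> (a j)) (v j)) - smul (\<iota> (- a s)) z \<in> B"
        using a unfolding sum_s by (simp add: iota_uminus)
      then have a0: "\<forall>j<s. a j = 0" using ind unfolding B'_def by blast
      then have "(\<Sum>j<s. smul (\<iota> (a j)) (v j)) = 0" by (intro sum.neutral) (auto simp: iota_0)
      then have as: "smul (\<iota> (a s)) z \<in> B" using a unfolding sum_s by simp
      have "a s = 0"
      proof (rule ccontr)
        assume "a s \<noteq> 0"
        then have "\<iota> (inverse (a s)) * \<iota> (a s) = 1" by (simp flip: iota_mult add: iota_1)
        then show False using subspace_scale[OF B as, of "\<iota> (inverse (a s))"] z by simp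
      qed
      then show "a j = 0" using a0 j by (auto simp: less_Suc_eq)
    next
      fix w assume "w \<in> Z"
      then obtain a t where "w - (\<Sum>j<s. smul (\<iota> (a j)) (v j)) - smul (\<iota> t) z \<in> B"
        using gen unfolding B'_def by blast
      then have "w - (\<Sum>j<Suc s. smul (\<iota> ((a(s := t)) j)) (?v j)) \<in> B"
        unfolding sum_s by (simp add: algebra_simps)
      then show "\<exists>a. w - (\<Sum>j<Suc s. smul (\<iota> (a j)) (?v j)) \<in> B" by blast
    next
      fix A c j assume A: "finite (A :: (nat \<Rightarrow> nat) set)" and j: "j < Suc s"
      let ?r = "poly_expr \<iota> x n A c"
      let ?e = "\<lambda>j. smul (\<iota> (poly_eval_pt n A c (?\<beta> j))) (?v j)"
      show "\<exists>a. smul ?r (?v j) - ?e j - (\<Sum>i\<in>{j<..<Suc s}. smul (\<iota> (a i)) (?v i)) \<in> B"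
      proof (cases "j = s")
        case True
        then show ?thesis using eig[of A c]
          by (auto simp: atLeastSucLessThan_greaterThanLessThan[symmetric])
      next
        case False
        then have "j < s" using j by simp
        then obtain a t where at: "smul ?r (?v j) - ?e j - (\<Sum>i\<in>{j<..<s}. smul (\<iota> (a i)) (v i)) - smul (\<iota> t) z \<in> B"
          using spec[OF spec[OF tri, of A], of c] A unfolding B'_def by auto
        have "{j<..<Suc s} = insert s {j<..<s}" using \<open>j < s\<close> by auto
        then have "(\<Sum>i\<in>{j<..<Suc s}. smul (\<iota> ((a(s := t)) i)) (?v i)) = (\<Sum>i\<in>{j<..<s}. smul (\<iota> (a i)) (v i)) + smul (\<iota> t) z"
          by (simp add: add.commute)
        then show ?thesis using at by (intro exI[of _ "a(s := t)"]) (simp only: diff_diff_add add.assoc)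
      qed
    qed
  qed
qed

end

context alg_module
begin

text \<open>\<open>V j\<close> is \<open>B\<close> plus the k-span of the basis vectors from index
  \<open>j\<close> on. Lower triangularity is exactly what makes it stable under
  \<open>R\<close>.\<close>

lemma filtration_of_triangularizable:
  assumes B: "subspace B" and g: "generates_alg \<iota> x n" and tri: "quot_triangularizable \<iota> smul x n Z B"
  shows "\<exists>(s::nat) V z. (\<forall>j\<le>s. subspace (V j)) \<and> V s = B \<and> Z \<subseteq> V 0 \<and>
           (\<forall>j<s. z j \<in> V j \<and> z j \<notin> V (Suc j) \<and> (\<forall>w\<in>V j. \<exists>t. w - smul (\<iota> t) (z j) \<in> V (Suc j)))"
proof -
  from tri obtain s :: nat and \<beta> z where z: "\<forall>j<s. z j \<in> Z"
    and ind: "\<forall>a. (\<Sum>j<s. smul (\<iota> (a j)) (z j)) \<in> B \<longrightarrow> (\<forall>j<s. a j = 0)"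
    and gen: "\<forall>w\<in>Z. \<exists>a. w - (\<Sum>j<s. smul (\<iota> (a j)) (z j)) \<in> B"
    and acts: "\<forall>A c. finite A \<longrightarrow> (\<forall>j<s. \<exists>a. smul (poly_expr \<iota> x n A c) (z j)
          - smul (\<iota> (poly_eval_pt n A c (\<beta> j))) (z j) - (\<Sum>i\<in>{j<..<s}. smul (\<iota> (a i)) (z i)) \<in> B)"
    by (rule quot_triangularizableE)
  define V where "V j = {w. \<exists>a. w - (\<Sum>i\<in>{j..<s}. smul (\<iota> (a i)) (z i)) \<in> B}" for j
  have add: "u + v \<in> V j" if "u \<in> V j" "v \<in> V j" for u v j
  proof -
    obtain a b where "u - (\<Sum>i\<in>{j..<s}. smul (\<iota> (a i)) (z i)) \<in> B" "v - (\<Sum>i\<in>{j..<s}. smul (\<iota> (b i)) (z i)) \<in> B"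
      using \<open>u \<in> V j\<close> \<open>v \<in> V j\<close> unfolding V_def by blast
    from subspace_add[OF B this] show ?thesis unfolding V_def
      by (intro CollectI exI[of _ "\<lambda>i. a i + b i"]) (simp add: iota_add scale_left_distrib sum.distrib algebra_simps)
  qed
  have kscale: "smul (\<iota> t) u \<in> V j" if "u \<in> V j" for u j t
  proof -
    obtain a where "u - (\<Sum>i\<in>{j..<s}. smul (\<iota> (a i)) (z i)) \<in> B" using \<open>u \<in> V j\<close> unfolding V_def by blast
    from subspace_scale[OF B this, of "\<iota> t"] show ?thesis unfolding V_def
      by (intro CollectI exI[of _ "\<lambda>i. t * a i"]) (simp add: iota_mult scale_right_diff_distrib scale_sum_right)
  qed
  have BV: "B \<subseteq> V j" for j unfolding V_def by (auto intro!: exI[of _ "\<lambda>_. 0"] simp: iota_0)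
  have sum: "sum f I \<in> V j" if "\<And>i. i \<in> I \<Longrightarrow> f i \<in> V j" for f and I :: "nat set" and j
    using that by (induction I rule: infinite_finite_induct) (use BV subspace_0[OF B] in \<open>auto intro: add\<close>)
  have zV: "z i \<in> V j" if "j \<le> i" "i < s" for i j
  proof -
    have "(\<Sum>l\<in>{j..<s}. smul (\<iota> (if l = i then 1 else 0)) (z l)) = (\<Sum>l\<in>{j..<s}. if l = i then z i else 0)"
      by (rule sum.cong) (auto simp: iota_1 iota_0)
    also have "\<dots> = z i" using that by simp
    finally show ?thesis unfolding V_def
      using subspace_0[OF B] by (intro CollectI exI[of _ "\<lambda>l. if l = i then 1 else 0"]) simp
  qed
  have V_sum: "w \<in> V j" if "w - u \<in> B" "u \<in> V j" for w u j
    using add[of "w - u" j u] BV that by auto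
  have scale_z: "smul r (z i) \<in> V j" if ij: "j \<le> i" "i < s" for r i j
  proof -
    obtain A c where A: "finite A" "r = poly_expr \<iota> x n A c" using g unfolding generates_alg_def by blast
    obtain a where a: "smul r (z i) - smul (\<iota> (poly_eval_pt n A c (\<beta> i))) (z i)
        - (\<Sum>l\<in>{i<..<s}. smul (\<iota> (a l)) (z l)) \<in> B" using acts A ij(2) by blast
    show ?thesis
      by (rule V_sum[of _ "smul (\<iota> (poly_eval_pt n A c (\<beta> i))) (z i) + (\<Sum>l\<in>{i<..<s}. smul (\<iota> (a l)) (z l))"])
        (use a ij in \<open>auto simp: diff_diff_add intro!: add kscale sum zV\<close>)
  qed
  have sub: "subspace (V j)" for j
  proof (rule subspaceI)
    fix r u assume "u \<in> V j"
    then obtain a where a: "u - (\<Sum>i\<in>{j..<s}. smul (\<iota> (a i)) (z i)) \<in> B" unfolding V_def by blast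
    have "smul r u - (\<Sum>i\<in>{j..<s}. smul (\<iota> (a i)) (smul r (z i))) \<in> B"
      using subspace_scale[OF B a, of r] by (simp add: scale_right_diff_distrib scale_sum_right mult.commute)
    then show "smul r u \<in> V j"
      by (rule V_sum) (auto intro!: sum kscale scale_z)
  qed (use BV subspace_0[OF B] add in blast)+
  have Vs: "V s = B" unfolding V_def by auto
  have "Z \<subseteq> V 0" using gen unfolding V_def by (auto simp: lessThan_atLeast0)
  moreover have "z j \<notin> V (Suc j)" if j: "j < s" for j
  proof
    assume "z j \<in> V (Suc j)"
    then obtain a where a: "z j - (\<Sum>i\<in>{Suc j..<s}. smul (\<iota> (a i)) (z i)) \<in> B" unfolding V_def by blast
    \<comment> \<open>Expressing \<open>z j\<close> through later vectors gives a dependence with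
      coefficient 1 at \<open>j\<close>, which contradicts independence.\<close>
    let ?a = "\<lambda>i. if i < j then 0 else if i = j then 1 else - a i"
    have split: "{..<s} = {..<j} \<union> insert j {Suc j..<s}" using j by auto
    have "(\<Sum>i<s. smul (\<iota> (?a i)) (z i)) = (\<Sum>i<j. smul (\<iota> (?a i)) (z i)) + (\<Sum>i\<in>insert j {Suc j..<s}. smul (\<iota> (?a i)) (z i))"
      unfolding split by (rule sum.union_disjoint) auto
    also have "\<dots> = z j - (\<Sum>i\<in>{Suc j..<s}. smul (\<iota> (a i)) (z i))"
      by (simp add: iota_0 iota_1 iota_uminus sum_negf)
    finally show False using a spec[OF ind, of ?a] j by auto
  qed
  moreover have "\<exists>t. w - smul (\<iota> t) (z j) \<in> V (Suc j)" if j: "j < s" "w \<in> V j" for j w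
  proof -
    obtain a where "w - (\<Sum>i\<in>{j..<s}. smul (\<iota> (a i)) (z i)) \<in> B" using j unfolding V_def by blast
    then have "w - smul (\<iota> (a j)) (z j) - (\<Sum>i\<in>{Suc j..<s}. smul (\<iota> (a i)) (z i)) \<in> B"
      using j(1) by (simp add: sum.atLeast_Suc_lessThan diff_diff_add)
    then show ?thesis unfolding V_def by blast
  qed
  ultimately show ?thesis using sub Vs zV by (intro exI[of _ s] exI[of _ V] exI[of _ z]) auto
qed

end

section \<open>Finite length, support and the Koszul complex\<close>

locale filtered_quotient = alg_module \<iota> smul
  for \<iota> :: "'k::field \<Rightarrow> 'r::comm_ring_1" and smul :: "'r \<Rightarrow> 'v::ab_group_add \<Rightarrow> 'v" +
  fixes s :: nat and V :: "nat \<Rightarrow> 'v set" and z :: "nat \<Rightarrow> 'v" and Z B :: "'v set"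
  assumes subspace_V: "\<And>j. j \<le> s \<Longrightarrow> subspace (V j)"
    and V_last: "V s = B" and V_0: "Z \<subseteq> V 0"
    and z_in: "\<And>j. j < s \<Longrightarrow> z j \<in> V j" and z_notin: "\<And>j. j < s \<Longrightarrow> z j \<notin> V (Suc j)"
    and V_step: "\<And>j w. j < s \<Longrightarrow> w \<in> V j \<Longrightarrow> \<exists>t. w - smul (\<iota> t) (z j) \<in> V (Suc j)"
begin

text \<open>The steps V_j/V_(j+1) in which \<open>N\<close> has a nonzero image, analogous to the
  pivot positions of an echelon form.\<close>

definition jumps :: "'v set \<Rightarrow> nat set" where
  "jumps N = {j. j < s \<and> (\<exists>w\<in>N \<inter> V j. w \<notin> V (Suc j))}"

text \<open>If both submodules had the same jumps, descending induction from \<open>V s = B\<close>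
  would put \<open>N' \<inter> V j\<close> into \<open>N\<close>: an element of \<open>N\<close>
  with the same jump cancels the leading term and moves the difference one step down.\<close>

lemma jumps_psubset:
  assumes N: "subspace N" "B \<subseteq> N" and N': "subspace N'" "N' \<subseteq> Z" and "N \<subset> N'"
  shows "jumps N \<subset> jumps N'"
proof
  show "jumps N \<subseteq> jumps N'" using assms(5) unfolding jumps_def by blast
  show "jumps N \<noteq> jumps N'"
  proof
    assume eq: "jumps N = jumps N'"
    have "N' \<inter> V j \<subseteq> N" if "j \<le> s" for j
      using that
    proof (induction j rule: inc_induct)
      case base
      then show ?case using N(2) V_last by blast
    next
      case (step j)
      note V' = subspace_V[OF Suc_leI[OF step.hyps(2)]]
      show ?case
      proof
        fix w assume w: "w \<in> N' \<inter> V j"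
        show "w \<in> N"
        proof (cases "w \<in> V (Suc j)")
          case True
          then show ?thesis using w step.IH by blast
        next
          case False
          then have "j \<in> jumps N" using w step.hyps eq unfolding jumps_def by blast
          then obtain v where v: "v \<in> N" "v \<in> V j" "v \<notin> V (Suc j)" unfolding jumps_def by blast
          obtain a b where a: "w - smul (\<iota> a) (z j) \<in> V (Suc j)" and b: "v - smul (\<iota> b) (z j) \<in> V (Suc j)"
            using V_step step.hyps w v by blast
          have "b \<noteq> 0" using b v by (auto simp: iota_0)
          \<comment> \<open>The ratio of the two leading coefficients, taken in the one-dimensional
            step.\<close>
          define c where "c = a / b"
          have "\<iota> c * \<iota> b = \<iota> a" using \<open>b \<noteq> 0\<close> by (simp add: c_def flip: iota_mult)
          then have "w - smul (\<iota> c) v = (w - smul (\<iota> a) (z j)) - smul (\<iota> c) (v - smul (\<iota> b) (z j))"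
            by (simp add: scale_right_diff_distrib)
          also have "\<dots> \<in> V (Suc j)" by (rule subspace_diff[OF V' a subspace_scale[OF V' b]])
          finally have "w - smul (\<iota> c) v \<in> V (Suc j)" .
          moreover have "w - smul (\<iota> c) v \<in> N'"
            using w v assms(5) by (intro subspace_diff[OF N'(1)] subspace_scale[OF N'(1)]) auto
          ultimately have "w - smul (\<iota> c) v \<in> N" using step.IH by blast
          then show ?thesis using subspace_cong[OF N(1)] subspace_scale[OF N(1) v(1)] by blast
        qed
      qed
    qed
    from this[of 0] show False using N'(2) V_0 assms(5) by auto
  qed
qed

lemma finite_length: "quot_finite_length smul Z B"
  unfolding quot_finite_length_def
proof (intro exI[of _ s] allI impI)
  fix N :: "nat \<Rightarrow> 'v set" and l
  assume N: "(\<forall>i\<le>l. submodule smul (N i) \<and> B \<subseteq> N i \<and> N i \<subseteq> Z) \<and> (\<forall>i<l. N i \<subset> N (Suc i))"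
  have fin: "finite (jumps X)" "card (jumps X) \<le> s" for X
    using card_mono[of "{..<s}" "jumps X"] finite_subset[of "jumps X" "{..<s}"] by (auto simp: jumps_def)
  have "i \<le> card (jumps (N i))" if "i \<le> l" for i
    using that
  proof (induction i)
    case (Suc i)
    have "jumps (N i) \<subset> jumps (N (Suc i))"
      using N Suc.prems by (intro jumps_psubset) (auto simp: submodule_iff)
    from psubset_card_mono[OF fin(1) this] show ?case using Suc by simp
  qed simp
  then show "l \<le> s" using fin(2) le_trans by blast
qed

definition step_ann :: "nat \<Rightarrow> 'r set" where
  "step_ann j = {r. smul r (z j) \<in> V (Suc j)}"

text \<open>Every \<open>r\<close> acts on the one-dimensional step as a scalar \<open>c\<close>. If
  \<open>r\<close> is not in the annihilator then \<open>c\<close> is nonzero, so an ideal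
  containing both contains the unit \<open>\<iota> c\<close>.\<close>

lemma maximal_step_ann:
  assumes j: "j < s"
  shows "maximal_ideal_in UNIV (step_ann j)"
proof -
  have V': "subspace (V (Suc j))" and V: "subspace (V j)" using subspace_V j by auto
  have I: "ideal_in UNIV (step_ann j)"
    unfolding ideal_in_def step_ann_def
    using V' by (auto simp: scale_left_distrib subspace_0 subspace_add simp flip: scale_scale intro: subspace_scale)
  have "1 \<notin> step_ann j" using z_notin[OF j] by (simp add: step_ann_def)
  moreover have "1 \<in> J" if J: "ideal_in UNIV J" "step_ann j \<subseteq> J" "J \<noteq> step_ann j" for J
  proof -
    obtain r where r: "r \<in> J" "r \<notin> step_ann j" using J by blast
    obtain c where c: "smul r (z j) - smul (\<iota> c) (z j) \<in> V (Suc j)"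
      using V_step[OF j subspace_scale[OF V z_in[OF j]]] by blast
    then have "r - \<iota> c \<in> step_ann j" by (simp add: step_ann_def scale_left_diff_distrib)
    then have "\<iota> c \<in> J" using ideal_cong[OF J(1) subring_UNIV, of r "\<iota> c"] J r by blast
    moreover have "c \<noteq> 0" using c r by (auto simp: step_ann_def iota_0)
    then have "\<iota> (inverse c) * \<iota> c = 1" by (simp flip: iota_mult add: iota_1)
    ultimately show ?thesis using ideal_in_mult[OF J(1), of "\<iota> (inverse c)" "\<iota> c"] by simp
  qed
  ultimately show ?thesis
    unfolding maximal_ideal_in_def using I ideal_in_eq_iff[OF _ subring_UNIV] by blast
qed

text \<open>If \<open>P\<close> contained no step annihilator, one could pick from each an element
  outside \<open>P\<close>. Their product pushes \<open>Z\<close> down the whole filtration into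
  \<open>B\<close> but avoids the prime \<open>P\<close>, which excludes \<open>P\<close> from the
  support; maximality then turns inclusion into equality.\<close>

lemma support_subset: "quot_support smul Z B \<subseteq> step_ann ` {..<s}"
proof
  fix P assume "P \<in> quot_support smul Z B"
  then obtain w where P: "prime_ideal P" and w: "w \<in> Z" "\<And>t. t \<notin> P \<Longrightarrow> smul t w \<notin> B"
    unfolding quot_support_def by blast
  have I: "ideal_in UNIV P" "P \<noteq> UNIV" and prime: "\<And>a b. a * b \<in> P \<Longrightarrow> a \<in> P \<or> b \<in> P"
    using P unfolding prime_ideal_def by auto
  have one: "1 \<notin> P" using I ideal_in_eq_iff[OF _ subring_UNIV] by blast
  have "\<exists>j<s. step_ann j \<subseteq> P"
  proof (rule ccontr)
    assume "\<not> ?thesis"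
    then have "\<forall>j. \<exists>t. j < s \<longrightarrow> t \<in> step_ann j \<and> t \<notin> P" by blast
    then obtain t where t: "\<And>j. j < s \<Longrightarrow> t j \<in> step_ann j" "\<And>j. j < s \<Longrightarrow> t j \<notin> P" by metis
    have "(\<Prod>i<j. t i) \<notin> P \<and> smul (\<Prod>i<j. t i) w \<in> V j" if "j \<le> s" for j
      using that
    proof (induction j)
      case 0
      then show ?case using one w(1) V_0 by auto
    next
      case (Suc j)
      then have j: "j < s" and V': "subspace (V (Suc j))" using subspace_V by auto
      let ?w = "smul (\<Prod>i<j. t i) w"
      obtain c where "?w - smul (\<iota> c) (z j) \<in> V (Suc j)" using V_step[OF j] Suc by auto
      then have "smul (t j) (?w - smul (\<iota> c) (z j)) \<in> V (Suc j)" by (rule subspace_scale[OF V'])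
      then have "smul (t j) ?w - smul (\<iota> c) (smul (t j) (z j)) \<in> V (Suc j)"
        by (simp add: scale_right_diff_distrib mult.commute)
      moreover have "smul (\<iota> c) (smul (t j) (z j)) \<in> V (Suc j)"
        by (rule subspace_scale[OF V']) (use t(1)[OF j] in \<open>simp add: step_ann_def\<close>)
      ultimately have "smul (t j) ?w \<in> V (Suc j)" using subspace_cong[OF V'] by blast
      then show ?case using Suc prime t(2)[OF j] by (auto simp: mult.commute)
    qed
    from this[of s] show False using w(2) V_last by auto
  qed
  then obtain j where j: "j < s" "step_ann j \<subseteq> P" by blast
  then have "P = step_ann j"
    using maximal_step_ann[OF j(1)] I unfolding maximal_ideal_in_def by blast
  then show "P \<in> step_ann ` {..<s}" using j by blast
qed

end

lemma (in alg_module) finite_length_and_support_of_triangularizable: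
  assumes "subspace B" "generates_alg \<iota> x n" "quot_triangularizable \<iota> smul x n Z B"
  shows "quot_finite_length smul Z B \<and> finite (quot_support smul Z B) \<and>
         (\<forall>P\<in>quot_support smul Z B. maximal_ideal_in UNIV P)"
proof -
  obtain s :: nat and V z where *: "\<forall>j\<le>s. subspace (V j)" "V s = B" "Z \<subseteq> V 0"
    "\<forall>j<s. z j \<in> V j \<and> z j \<notin> V (Suc j) \<and> (\<forall>w\<in>V j. \<exists>t. w - smul (\<iota> t) (z j) \<in> V (Suc j))"
    using filtration_of_triangularizable[OF assms] by (elim exE conjE) (rule that; assumption)
  interpret filtered_quotient \<iota> smul s V z Z B
    by unfold_locales (use * in blast)+
  show ?thesis
    using finite_length support_subset maximal_step_ann finite_subset[OF support_subset] by blast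
qed

text \<open>Products of the generators of \<open>R\<close> over \<open>S\<close> with those of
  \<open>Z\<close> over \<open>R\<close> generate \<open>Z\<close> over \<open>S\<close>; as
  \<open>S\<close> acts by scalars modulo \<open>B\<close>, they span over k.\<close>

lemma (in alg_module) quot_fin_dimI:
  assumes Z: "subspace Z" and B: "subspace B" and G: "finite G" "G \<subseteq> Z" "Z \<subseteq> span G"
    and F: "finite F" "sspan S F = UNIV" and S: "\<And>r. r \<in> S \<Longrightarrow> acts_as_scalar \<iota> smul Z B r"
  shows "quot_fin_dim \<iota> smul Z B"
proof -
  interpret K: module "\<lambda>c. smul (\<iota> c)"
    by unfold_locales (auto simp: iota_add iota_mult iota_1 scale_right_distrib scale_left_distrib)
  define H where "H = (\<lambda>(f, g). smul f g) ` (F \<times> G)"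
  have H: "finite H" "H \<subseteq> Z" using F G Z unfolding H_def by (auto intro: subspace_scale)
  define T where "T = {w. \<exists>u\<in>K.span H. w - u \<in> B}"
  have BT: "w \<in> T" if "w \<in> B" for w using that K.span_zero unfolding T_def by force
  have add: "u + w \<in> T" if "u \<in> T" "w \<in> T" for u w
  proof -
    obtain u' w' where "u' \<in> K.span H" "u - u' \<in> B" "w' \<in> K.span H" "w - w' \<in> B"
      using \<open>u \<in> T\<close> \<open>w \<in> T\<close> unfolding T_def by blast
    then have "u' + w' \<in> K.span H" "(u - u') + (w - w') \<in> B"
      by (auto intro: K.span_add subspace_add[OF B])
    then show ?thesis unfolding T_def by (auto simp: algebra_simps intro!: bexI[of _ "u' + w'"])
  qed
  have T: "smul r g \<in> T" if "r \<in> sspan S F" "g \<in> G" for r g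
    using that
  proof (induction rule: sspan.induct)
    case zero
    then show ?case using BT subspace_0[OF B] by simp
  next
    case (step a f u)
    have fg: "smul f g \<in> H" using step by (auto simp: H_def)
    then obtain c where c: "smul a (smul f g) - smul (\<iota> c) (smul f g) \<in> B"
      using S[OF step.hyps(1)] H(2) unfolding acts_as_scalar_def by blast
    have "smul (\<iota> c) (smul f g) \<in> K.span H" by (intro K.span_scale K.span_base fg)
    then have "smul a (smul f g) \<in> T" using c unfolding T_def by blast
    then show ?case using add step by (simp add: scale_left_distrib)
  qed
  have "\<exists>a. w - (\<Sum>f\<in>H. smul (\<iota> (a f)) f) \<in> B" if w: "w \<in> Z" for w
  proof -
    obtain a where "w = (\<Sum>g\<in>G. smul (a g) g)" using w G span_finite[OF G(1)] by blast
    moreover have "(\<Sum>g\<in>G'. smul (a g) g) \<in> T" if "G' \<subseteq> G" for G'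
      using finite_subset[OF that G(1)] that
      by (induction rule: finite_induct) (use BT subspace_0[OF B] T F(2) in \<open>auto intro: add\<close>)
    ultimately have "w \<in> T" by blast
    then show ?thesis unfolding T_def K.span_finite[OF H(1)] by blast
  qed
  then show ?thesis using H unfolding quot_fin_dim_def by blast
qed

text \<open>In a monic equation of \<open>r\<close> over \<open>S\<close>, each coefficient is
  replaced by the scalar through which it acts.\<close>

lemma (in alg_module) integral_annihilator:
  assumes B: "subspace B" and Z: "subspace Z"
    and S: "\<And>r. r \<in> S \<Longrightarrow> acts_as_scalar \<iota> smul Z B r" and int: "integral_over S"
  shows "\<exists>p. p \<noteq> 0 \<and> (\<forall>w\<in>Z. smul (poly (map_poly \<iota> p) r) w \<in> B)"
proof -
  obtain q where q: "lead_coeff q = 1" "\<forall>i. coeff q i \<in> S" "poly q r = 0"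
    using int unfolding integral_over_def by blast
  let ?d = "degree q"
  \<comment> \<open>If \<open>Z\<close> lies in \<open>B\<close>, any scalar represents the action;
    choosing 1 for the leading coefficient ensures that the resulting polynomial is nonzero.\<close>
  have "\<exists>c. (i = ?d \<longrightarrow> c = 1) \<and> (\<forall>w\<in>Z. smul (coeff q i) w - smul (\<iota> c) w \<in> B)" for i
  proof (cases "i = ?d")
    case True
    then show ?thesis using q(1) subspace_0[OF B] by (intro exI[of _ 1]) (auto simp: iota_1)
  next
    case False
    then show ?thesis using S q(2) unfolding acts_as_scalar_def by blast
  qed
  then obtain c where c: "c ?d = 1" "\<And>i w. w \<in> Z \<Longrightarrow> smul (coeff q i) w - smul (\<iota> (c i)) w \<in> B" by metis
  define p where "p = (\<Sum>i\<le>?d. monom (c i) i)"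
  have p: "coeff p i = (if i \<le> ?d then c i else 0)" for i
    by (cases "i \<le> ?d") (auto simp: p_def coeff_sum)
  have "coeff p ?d \<noteq> 0" using c(1) by (simp add: p)
  then have "p \<noteq> 0" by auto
  have "degree (map_poly \<iota> p) \<le> ?d"
    by (rule degree_le) (simp add: coeff_map_poly iota_0 p)
  then have ev: "poly (map_poly \<iota> p) r = (\<Sum>i\<le>?d. \<iota> (c i) * r ^ i)"
    by (subst poly_as_sum_of_monoms'[symmetric, of _ ?d])
      (auto simp: poly_sum poly_monom coeff_map_poly iota_0 p)
  have "smul (poly (map_poly \<iota> p) r) w \<in> B" if w: "w \<in> Z" for w
  proof -
    \<comment> \<open>The scalars are valid on all of \<open>Z\<close>, hence on
      \<open>smul (r ^ i) w\<close>.\<close>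
    have "(\<Sum>i\<le>?d. smul (coeff q i) (smul (r ^ i) w) - smul (\<iota> (c i)) (smul (r ^ i) w)) \<in> B"
      by (intro subspace_sum[OF B] c(2) subspace_scale[OF Z] w)
    also have "(\<Sum>i\<le>?d. smul (coeff q i) (smul (r ^ i) w) - smul (\<iota> (c i)) (smul (r ^ i) w)) =
        smul (poly q r) w - smul (poly (map_poly \<iota> p) r) w"
      unfolding ev poly_altdef[of q] by (simp add: sum_subtractf scale_sum_left)
    finally show ?thesis using q(3) subspace_neg[OF B] by fastforce
  qed
  then show ?thesis using \<open>p \<noteq> 0\<close> by blast
qed

section \<open>Finite generation of chain submodules and the Koszul homotopy\<close>

lemma sum_fun_apply: "(\<Sum>i\<in>I. f i) J = (\<Sum>i\<in>I. f i J)"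
  by (induction I rule: infinite_finite_induct) auto

lemma chain_smul_apply: "chain_smul smul r c J = smul r (c J)"
  by (simp add: chain_smul_def)

lemma module_chain_smul: "module smul \<Longrightarrow> module (chain_smul smul)"
  unfolding module_def chain_smul_def by (auto simp: fun_eq_iff)

text \<open>Finite powers of \<open>M\<close> are Noetherian: the values at one index
  \<open>J\<close> form a finitely generated submodule of \<open>M\<close>, and the elements of
  \<open>N\<close> vanishing at \<open>J\<close> are covered by induction. Lifts of the first
  generators together with the second ones generate \<open>N\<close>.\<close>

lemma noetherian_chains:
  fixes smul :: "'r::comm_ring_1 \<Rightarrow> 'm::ab_group_add \<Rightarrow> 'm"
  assumes m: "module smul" and noeth: "noetherian_module smul" and "finite S"
    and "module.subspace (chain_smul smul) N" "\<And>c J. c \<in> N \<Longrightarrow> J \<notin> S \<Longrightarrow> c J = 0"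
  shows "\<exists>G. finite G \<and> G \<subseteq> N \<and> N \<subseteq> module.span (chain_smul smul) G"
  using assms(3-)
proof (induction S arbitrary: N rule: finite_induct)
  case empty
  then have "N \<subseteq> {0}" by (auto simp: fun_eq_iff)
  then show ?case using module.span_zero[OF module_chain_smul[OF m]] by blast
next
  case (insert J S)
  interpret M: module smul by (rule m)
  interpret C: module "chain_smul smul" by (rule module_chain_smul[OF m])
  note N = insert.prems(1)
  let ?pr = "(\<lambda>c. c J) ` N"
  have "submodule smul ?pr"
    unfolding submodule_def
  proof (intro conjI ballI allI)
    show "0 \<in> ?pr" by (rule image_eqI[OF _ C.subspace_0[OF N]]) simp
    fix a assume "a \<in> ?pr"
    then obtain c where c: "c \<in> N" "a = c J" by blast
    show "a + b \<in> ?pr" if b: "b \<in> ?pr" for b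
    proof -
      obtain d where d: "d \<in> N" "b = d J" using b by blast
      show ?thesis by (rule image_eqI[OF _ C.subspace_add[OF N c(1) d(1)]]) (simp add: c d)
    qed
    show "smul r a \<in> ?pr" for r
      by (rule image_eqI[OF _ C.subspace_scale[OF N c(1), of r]]) (simp add: c chain_smul_def)
  qed
  then obtain F where F: "finite F" "F \<subseteq> ?pr" "?pr = mod_span smul F"
    using noeth[unfolded noetherian_module_def, rule_format] by metis
  have "\<forall>f\<in>F. \<exists>c. c \<in> N \<and> c J = f" using F(2) by blast
  then obtain h where h: "\<And>f. f \<in> F \<Longrightarrow> h f \<in> N" "\<And>f. f \<in> F \<Longrightarrow> h f J = f" by metis
  let ?N' = "{c \<in> N. c J = 0}"
  have "C.subspace ?N'"
    using N unfolding C.subspace_def by (simp add: chain_smul_apply)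
  moreover have "c K = 0" if "c \<in> ?N'" "K \<notin> S" for c K
    using that insert.prems(2)[of c K] by (cases "K = J") auto
  ultimately obtain G where G: "finite G" "G \<subseteq> ?N'" "?N' \<subseteq> C.span G" using insert.IH[of ?N'] by blast
  have "c \<in> C.span (h ` F \<union> G)" if c: "c \<in> N" for c
  proof -
    have "c J \<in> mod_span smul F" using F(3) c by blast
    then obtain a where a: "c J = (\<Sum>f\<in>F. smul (a f) f)" unfolding mod_span_def by blast
    define u where "u = (\<Sum>f\<in>F. chain_smul smul (a f) (h f))"
    have "u J = c J" using h(2) by (simp add: u_def sum_fun_apply chain_smul_def a)
    moreover have "u \<in> N" unfolding u_def using h(1) by (intro C.subspace_sum[OF N] C.subspace_scale[OF N])
    ultimately have "c - u \<in> ?N'" using C.subspace_diff[OF N c] by simp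
    then have "c - u \<in> C.span (h ` F \<union> G)" using G(3) C.span_mono[of G "h ` F \<union> G"] by blast
    moreover have "u \<in> C.span (h ` F \<union> G)"
      unfolding u_def by (intro C.span_sum C.span_scale C.span_base) auto
    ultimately show ?thesis using C.span_add by fastforce
  qed
  then show ?case using F(1) G(1,2) h(1) by (intro exI[of _ "h ` F \<union> G"]) auto
qed

context module
begin

lemma koszul_d_alt:
  "koszul_d scale y m c J = (\<Sum>i\<in>{..<m} - J. scale ((- 1) ^ card {j\<in>J. j < i} * y i) (c (insert i J)))"
  unfolding koszul_d_def by (rule sum.cong) auto

lemma koszul_d_add: "koszul_d scale y m (c + c') = koszul_d scale y m c + koszul_d scale y m c'"
  by (rule ext) (simp add: koszul_d_alt scale_right_distrib sum.distrib)

lemma koszul_d_scale: "koszul_d scale y m (chain_smul scale r c) = chain_smul scale r (koszul_d scale y m c)"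
  by (rule ext) (simp add: koszul_d_alt chain_smul_def scale_sum_right mult_ac)

lemma koszul_d_0: "koszul_d scale y m 0 = 0"
  by (rule ext) (simp add: koszul_d_alt)

lemma subspace_koszul_chains: "module.subspace (chain_smul scale) (koszul_chains m p)"
proof -
  interpret C: module "chain_smul scale" by (rule module_chain_smul[OF module_axioms])
  have eq: "koszul_chains m p = {c. \<forall>J. \<not> (J \<subseteq> {..<m} \<and> card J = p) \<longrightarrow> c J = 0}"
    unfolding koszul_chains_def by blast
  show ?thesis unfolding eq C.subspace_def by (simp add: chain_smul_apply)
qed

lemma subspace_koszul_cycles: "module.subspace (chain_smul scale) (koszul_cycles scale y m p)"
proof -
  interpret C: module "chain_smul scale" by (rule module_chain_smul[OF module_axioms])
  show ?thesis
    using subspace_koszul_chains[of m p] unfolding koszul_cycles_def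
    by (auto simp: C.subspace_def koszul_d_add koszul_d_scale koszul_d_0)
qed

lemma subspace_koszul_boundaries: "module.subspace (chain_smul scale) (koszul_boundaries scale y m p)"
proof -
  interpret C: module "chain_smul scale" by (rule module_chain_smul[OF module_axioms])
  interpret module_hom "chain_smul scale" "chain_smul scale" "koszul_d scale y m"
    by unfold_locales (simp_all add: koszul_d_add koszul_d_scale)
  show ?thesis unfolding koszul_boundaries_def by (rule subspace_image[OF subspace_koszul_chains])
qed

text \<open>Exterior multiplication by \<open>e\<^sub>i\<close> is a homotopy between multiplication by \<open>y\<^sub>i\<close> and zero.\<close>

lemma koszul_homotopy:
  assumes c: "c \<in> koszul_cycles scale y m p" and i: "i < m"
  shows "chain_smul scale (y i) c \<in> koszul_boundaries scale y m p"
proof -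
  have ch: "\<And>J. c J \<noteq> 0 \<Longrightarrow> J \<subseteq> {..<m} \<and> card J = p" and d0: "koszul_d scale y m c = 0"
    using c by (auto simp: koszul_cycles_def koszul_chains_def)
  let ?n = "\<lambda>J l. card {j\<in>J. j < l}"
  \<comment> \<open>This is \<open>e_i\<close> wedge \<open>c\<close>; the sign counts the factors
    that \<open>e_i\<close> has to pass.\<close>
  define h where "h J = (if i \<in> J then scale ((- 1) ^ ?n J i) (c (J - {i})) else 0)" for J
  have "h \<in> koszul_chains m (Suc p)"
    unfolding koszul_chains_def
  proof (intro CollectI allI impI)
    fix J assume "h J \<noteq> 0"
    then have J: "i \<in> J" "c (J - {i}) \<noteq> 0" by (auto simp: h_def split: if_splits)
    then have sub: "J - {i} \<subseteq> {..<m}" and card: "card (J - {i}) = p" using ch by auto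
    then have "J \<subseteq> {..<m}" using i by auto
    then show "J \<subseteq> {..<m} \<and> card J = Suc p"
      using card_Suc_Diff1[OF finite_subset[of J "{..<m}"] J(1)] card by simp
  qed
  moreover have "koszul_d scale y m h J = scale (y i) (c J)" for J
  proof (cases "i \<in> J")
    case False
    \<comment> \<open>\<open>h\<close> vanishes on sets without \<open>i\<close>, so only inserting
      \<open>i\<close> contributes, and its sign occurs squared.\<close>
    have "koszul_d scale y m h J = (\<Sum>l\<in>{..<m} - J. if l = i then scale (y i) (c J) else 0)"
      unfolding koszul_d_alt
    proof (rule sum.cong[OF refl])
      fix l assume l: "l \<in> {..<m} - J"
      show "scale ((- 1) ^ ?n J l * y l) (h (insert l J)) = (if l = i then scale (y i) (c J) else 0)"
      proof (cases "l = i")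
        case True
        have "{j \<in> insert i J. j < i} = {j \<in> J. j < i}" by auto
        then show ?thesis using True False by (simp add: h_def mult_ac flip: power_add mult_2)
      qed (use False in \<open>auto simp: h_def\<close>)
    qed
    then show ?thesis using False i by simp
  next
    case True
    let ?K = "J - {i}"
    \<comment> \<open>The cycle condition for \<open>c\<close> at \<open>J - {i}\<close> expresses
      this sum through \<open>y i\<close> and \<open>c J\<close>.\<close>
    let ?S = "\<Sum>l\<in>{..<m} - J. scale ((- 1) ^ ?n ?K l * y l) (c (insert l ?K))"
    have nK: "{j \<in> J. j \<noteq> i \<and> j < i} = {j \<in> J. j < i}" by auto
    have "{..<m} - ?K = insert i ({..<m} - J)" using True i by auto
    moreover have "insert i ?K = J" using True by auto
    ultimately have "0 = scale ((- 1) ^ ?n J i * y i) (c J) + ?S"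
      using fun_cong[OF d0, of ?K] True by (simp add: koszul_d_alt nK)
    then have S: "?S = - scale ((- 1) ^ ?n J i * y i) (c J)" by (simp add: eq_neg_iff_add_eq_0 add.commute)
    have "koszul_d scale y m h J = (\<Sum>l\<in>{..<m} - J. scale (- ((- 1) ^ ?n J i)) (scale ((- 1) ^ ?n ?K l * y l) (c (insert l ?K))))"
      unfolding koszul_d_alt
    proof (rule sum.cong[OF refl])
      fix l assume l: "l \<in> {..<m} - J"
      then have li: "l \<noteq> i" using True by auto
      have e: "insert l J - {i} = insert l ?K" using li by auto
      have fin: "finite {j \<in> X. j < a}" for X and a :: nat by simp
      \<comment> \<open>Anticommutation of \<open>e_i\<close> and \<open>e_l\<close>: the smaller of
        the two indices is counted once on one side and not on the other.\<close>
      have sgn: "(- 1) ^ ?n J l * (- 1) ^ ?n (insert l J) i = - ((- 1 :: 'a) ^ ?n J i * (- 1) ^ ?n ?K l)"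
      proof (cases "l < i")
        case True
        have "{j \<in> insert l J. j < i} = insert l {j \<in> J. j < i}" "{j \<in> J. j < l} = {j \<in> ?K. j < l}"
          using True by auto
        then show ?thesis using l fin by simp
      next
        case False
        have "{j \<in> insert l J. j < i} = {j \<in> J. j < i}" "{j \<in> J. j < l} = insert i {j \<in> ?K. j < l}"
          using False li \<open>i \<in> J\<close> by auto
        then show ?thesis using l fin by (simp add: mult.commute)
      qed
      have "scale ((- 1) ^ ?n J l * y l) (h (insert l J)) =
          scale (((- 1) ^ ?n J l * (- 1) ^ ?n (insert l J) i) * y l) (c (insert l ?K))"
        using True by (simp add: h_def e mult_ac)
      also have "\<dots> = scale (- ((- 1) ^ ?n J i)) (scale ((- 1) ^ ?n ?K l * y l) (c (insert l ?K)))"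
        unfolding sgn by (simp add: mult_ac)
      finally show "scale ((- 1) ^ ?n J l * y l) (h (insert l J)) =
          scale (- ((- 1) ^ ?n J i)) (scale ((- 1) ^ ?n ?K l * y l) (c (insert l ?K)))" .
    qed
    also have "\<dots> = scale (- ((- 1) ^ ?n J i)) ?S" by (rule scale_sum_right[symmetric])
    also have "\<dots> = scale (y i) (c J)"
      unfolding S by (simp add: mult.assoc[symmetric] flip: power_add mult_2)
    finally show ?thesis .
  qed
  then have "chain_smul scale (y i) c = koszul_d scale y m h" by (auto simp: chain_smul_def)
  ultimately show ?thesis unfolding koszul_boundaries_def by blast
qed

end

theorem theorem2p8:
  fixes \<iota> :: "'k::alg_closed_field \<Rightarrow> 'r::comm_ring_1"
    and R' :: "'r set"
    and smul :: "'r \<Rightarrow> 'm::ab_group_add \<Rightarrow> 'm"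
    and y :: "nat \<Rightarrow> 'r" and m :: nat
  assumes "inj_ring_hom \<iota>"
    and "subring R'" and "range \<iota> \<subseteq> R'"
    and "fin_gen_alg \<iota>"
    and "integral_over R'"
    and "is_module smul" and "noetherian_module smul"
    and "\<forall>i<m. y i \<in> R'"
    and "maximal_ideal_in R' (gen_ideal_in R' y m)"
  shows "\<forall>p. let Z = koszul_cycles smul y m p; B = koszul_boundaries smul y m p;
               sm = chain_smul smul in
           quot_fin_dim \<iota> sm Z B \<and>
           (\<forall>r\<in>R'. acts_as_scalar \<iota> sm Z B r) \<and>
           quot_finite_length sm Z B \<and>
           (\<forall>x n. generates_alg \<iota> x n \<longrightarrow> quot_triangularizable \<iota> sm x n Z B) \<and>
           finite (quot_support sm Z B) \<and>
           (\<forall>P\<in>quot_support sm Z B. maximal_ideal_in UNIV P)"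
proof
  fix p
  interpret M: module smul using assms(6) by (simp add: is_module_iff)
  interpret C: alg_closed_module \<iota> "chain_smul smul"
    using assms(1) module_chain_smul[OF M.module_axioms]
    by (simp add: alg_closed_module_def alg_closed_struct_def alg_struct_def alg_module_def)
  let ?Z = "koszul_cycles smul y m p" and ?B = "koszul_boundaries smul y m p" and ?sm = "chain_smul smul"
  note Z = M.subspace_koszul_cycles[of y m p] and B = M.subspace_koszul_boundaries[of y m p]
  have kills: "?sm r c \<in> ?B" if r: "r \<in> gen_ideal_in R' y m" and c: "c \<in> ?Z" for r c
  proof -
    obtain a where "r = (\<Sum>i<m. a i * y i)" using r unfolding gen_ideal_in_def by blast
    then have "?sm r c = (\<Sum>i<m. ?sm (a i) (?sm (y i) c))" by (simp add: C.scale_sum_left)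
    also have "\<dots> \<in> ?B"
      by (intro C.subspace_sum[OF B] C.subspace_scale[OF B] M.koszul_homotopy[OF c]) auto
    finally show ?thesis .
  qed
  have scalar: "acts_as_scalar \<iota> ?sm ?Z ?B r" if r: "r \<in> R'" for r
  proof -
    obtain c where "r - \<iota> c \<in> gen_ideal_in R' y m"
      using C.residue_field[OF assms(2-5,8,9) r] by blast
    from kills[OF this] show ?thesis
      unfolding acts_as_scalar_def by (auto simp: C.scale_left_diff_distrib)
  qed
  obtain F where F: "finite F" "sspan R' F = UNIV" using C.finite_over_subring[OF assms(2-5)] by blast
  have "c J = 0" if "c \<in> ?Z" "J \<notin> Pow {..<m}" for c J
    using that by (auto simp: koszul_cycles_def koszul_chains_def)
  \<comment> \<open>Chains live on the finitely many subsets of \<open>{..<m}\<close>, so the cycles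
    form a submodule of a finite power of \<open>M\<close>.\<close>
  then obtain G where G: "finite G" "G \<subseteq> ?Z" "?Z \<subseteq> C.span G"
    using noetherian_chains[OF M.module_axioms assms(7) _ Z, of "Pow {..<m}"] by auto
  have fin: "quot_fin_dim \<iota> ?sm ?Z ?B" by (rule C.quot_fin_dimI[OF Z B G F scalar])
  then obtain H where H: "finite H" "\<And>w. w \<in> ?Z \<Longrightarrow> \<exists>a. w - (\<Sum>f\<in>H. ?sm (\<iota> (a f)) f) \<in> ?B"
    unfolding quot_fin_dim_def by blast
  have tri: "quot_triangularizable \<iota> ?sm x n ?Z ?B" if "generates_alg \<iota> x n" for x n
    using C.integral_annihilator[OF B Z scalar assms(5)] H(2)
    by (intro C.triangularizable[OF H(1) B Z that])
  \<comment> \<open>Finite length and support do not depend on generators of \<open>R\<close>, so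
    any one generating tuple supplies the triangular basis for them.\<close>
  obtain x n where x: "generates_alg \<iota> x n" using assms(4) unfolding fin_gen_alg_def by blast
  show "let Z = ?Z; B = ?B; sm = ?sm in
           quot_fin_dim \<iota> sm Z B \<and>
           (\<forall>r\<in>R'. acts_as_scalar \<iota> sm Z B r) \<and>
           quot_finite_length sm Z B \<and>
           (\<forall>x n. generates_alg \<iota> x n \<longrightarrow> quot_triangularizable \<iota> sm x n Z B) \<and>
           finite (quot_support sm Z B) \<and>
           (\<forall>P\<in>quot_support sm Z B. maximal_ideal_in UNIV P)"
    unfolding Let_def
    using fin scalar tri C.finite_length_and_support_of_triangularizable[OF B x tri[OF x]] by blast
qed

end
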